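(* Let $t\ge2$ and $1\le m<t$ be integers. Then for every $x\in\mathbb{C}\setminus\{0\}$ for which all terms below are defined (that is, $-x^{2t-1}$ is not an integer power of $q^{2t-1}$ and $x^{2t}$ is not an integer power of $q$), $$\begin{aligned} f_{t,m}(x) ={}& x^{-2t+m+1}\, m(x^{-2t+1} q^{m},-x^{2t-1}; q^{2t-1}) +x^{-m}\, m(x^{-2t+1}q^{2t-1-m} ,-x^{2t-1};q^{2t-1}) \\ &- \frac{x^{-2t}}{\Theta(-x^{2t-1};q^{2t-1})(q)_{\infty}^3} \sum_{k=0}^{2t-1} x^k q^{k}\theta_{t+k,m+k} \\ &\quad\times\sum_{s=0}^{2t-1} (-1)^s q^{\binom{s}{2}}\Theta(q^{(2t-1)(t-s)}; q^{2t(2t-1)})\, x^s\, \Theta(q^sx^{2t};q^{2t})\,m(-q^{k}x^{-2t}, q^s x^{2t}; q^{2t}). \end{aligned}$$ Here $m(\cdot,\cdot;\cdot)$ denotes the Appell function and $m$ in exponents and indices denotes the integer.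
   Context: Throughout, $q\in\mathbb{C}$ with $0<|q|<1$. $(x;q)_\infty=\prod_{i\ge0}(1-xq^i)$, $(q)_\infty=(q;q)_\infty$, and $\Theta(x;q)=(x;q)_\infty(q/x;q)_\infty(q;q)_\infty=\sum_{n\in\mathbb{Z}}(-1)^nq^{\binom n2}x^n$ (and likewise with $q$ replaced by a power of $q$). Appell function: $$m(x,z;q)=\frac{1}{\Theta(z;q)}\sum_{r=-\infty}^{\infty}\frac{(-1)^rq^{\binom{r}{2}}z^r}{1-q^{r-1}xz}.$$ $\mathrm{sg}(r)=1$ if $r\ge0$ and $-1$ if $r<0$; $\mathrm{sg}(r,s)=\frac{\mathrm{sg}(r)+\mathrm{sg}(s)}{2}$. For integers $t\geq 1$, $m$ define $$g_{t,m}(x) = \sum_{\substack{r,s\in\mathbb{Z}\\ r\equiv s\ (\mathrm{mod}\ 2)}} \mathrm{sg}(r,s) \frac{(-1)^{\frac{r-s}{2}}q^{\frac{r^2}{8}+\frac{4t-1}{4}rs+\frac{s^2}{8}+\frac{4t-1-2m}{4}r+\frac{1+2m}{4}s}}{1-xq^{\frac{r+s}{2}}},\qquad f_{t,m}(x)=\frac{\Theta(x;q)}{(q)_\infty^3}g_{t,m}(x).$$ For the fixed $t$ and $p,m\in\mathbb{Z}$ define $$\theta_{p,m} = \sum_{\substack{r,s\in\mathbb{Z}\\ r\equiv s\ (\mathrm{mod}\ 2)}} \mathrm{sg}(r,s) (-1)^{\frac{r-s}{2}}q^{\frac{r^2}{8}+\frac{4t-1}{4}rs+\frac{s^2}{8}+\frac{4p-1-2m}{4}r+\frac{1+2m}{4}s}.$$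 *)

theory Defs
  imports "HOL-Analysis.Analysis"
begin

text \<open>
  The nome \<open>q\<close> is an explicit argument everywhere (in the application \<open>0 < |q| < 1\<close>), and all
  exponents are integers. Bilateral and double series are unordered sums (\<open>infsum\<close>); for
  \<open>0 < |q| < 1\<close>, \<open>z \<noteq> 0\<close> and nonvanishing denominators all of them converge absolutely.
\<close>

definition qpoch :: "complex \<Rightarrow> complex \<Rightarrow> complex" where
  "qpoch x q = (\<Prod>i. 1 - x * q ^ i)"

definition Theta :: "complex \<Rightarrow> complex \<Rightarrow> complex" where
  "Theta x q = qpoch x q * qpoch (q / x) q * qpoch q q"

text \<open>For an integer \<open>r\<close>, possibly negative, \<open>r * (r - 1) div 2\<close> is the binomial coefficient
  \<open>r\<close> over 2.\<close>

definition appell :: "complex \<Rightarrow> complex \<Rightarrow> complex \<Rightarrow> complex" where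
  "appell x z q =
     1 / Theta z q *
     (\<Sum>\<^sub>\<infinity>r\<in>(UNIV :: int set).
        ((- 1) powi r * q powi (r * (r - 1) div 2) * z powi r) / (1 - q powi (r - 1) * x * z))"

definition sg :: "int \<Rightarrow> complex" where
  "sg r = (if r \<ge> 0 then 1 else - 1)"

definition sg2 :: "int \<Rightarrow> int \<Rightarrow> complex" where
  "sg2 r s = (sg r + sg s) / 2"

definition same_parity :: "(int \<times> int) set" where
  "same_parity = {(r, s). r mod 2 = s mod 2}"

text \<open>
  The exponent of \<open>q\<close> in the double sums is an integer whenever \<open>r\<close> and \<open>s\<close> have the same parity,
  so the division by 8 below is exact there; see \<open>real_qexpo\<close>.
\<close>

definition qexpo :: "int \<Rightarrow> int \<Rightarrow> int \<Rightarrow> int \<Rightarrow> int \<Rightarrow> int" where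
  "qexpo t p m r s =
     (r\<^sup>2 + 2 * (4 * t - 1) * r * s + s\<^sup>2 + 2 * (4 * p - 1 - 2 * m) * r + 2 * (1 + 2 * m) * s) div 8"

lemma real_qexpo:
  assumes "(r, s) \<in> same_parity"
  shows "real_of_int (qexpo t p m r s) =
     r\<^sup>2 / 8 + (4 * t - 1) / 4 * r * s + s\<^sup>2 / 8 + (4 * p - 1 - 2 * m) / 4 * r + (1 + 2 * m) / 4 * s"
proof -
  let ?N = "r\<^sup>2 + 2 * (4 * t - 1) * r * s + s\<^sup>2 + 2 * (4 * p - 1 - 2 * m) * r + 2 * (1 + 2 * m) * s"
  from assms have "2 dvd r - s"
    by (simp add: same_parity_def mod_eq_dvd_iff)
  then obtain k where k: "r = s + 2 * k"
    by (metis add.commute diff_add_cancel dvdE)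
  have "even (k * (k - 1))" by simp
  then obtain j where j: "k * (k - 1) = 2 * j" by (elim dvdE)
  have "?N = 8 * (t * s\<^sup>2 + 2 * t * k * s + p * s + (2 * p - m) * k) + 4 * (k * (k - 1))"
    unfolding k by (simp add: power2_eq_square algebra_simps)
  then have "8 dvd ?N" unfolding j by simp
  then have "8 * qexpo t p m r s = ?N"
    unfolding qexpo_def by simp
  then have "8 * real_of_int (qexpo t p m r s) = real_of_int ?N"
    by (metis of_int_mult of_int_numeral)
  then show ?thesis by (simp add: field_simps)
qed

definition g_fun :: "complex \<Rightarrow> int \<Rightarrow> int \<Rightarrow> complex \<Rightarrow> complex" where
  "g_fun q t m x =
     (\<Sum>\<^sub>\<infinity>(r, s)\<in>same_parity.
        sg2 r s * ((- 1) powi ((r - s) div 2) * q powi qexpo t t m r s)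
          / (1 - x * q powi ((r + s) div 2)))"

definition f_fun :: "complex \<Rightarrow> int \<Rightarrow> int \<Rightarrow> complex \<Rightarrow> complex" where
  "f_fun q t m x = Theta x q / qpoch q q ^ 3 * g_fun q t m x"

definition theta_coeff :: "complex \<Rightarrow> int \<Rightarrow> int \<Rightarrow> int \<Rightarrow> complex" where
  "theta_coeff q t p m =
     (\<Sum>\<^sub>\<infinity>(r, s)\<in>same_parity.
        sg2 r s * (- 1) powi ((r - s) div 2) * q powi qexpo t p m r s)"

end

theory Submission
  imports Defs "HOL-Complex_Analysis.Complex_Analysis"
begin

text \<open>Put \<open>n = (r + s) / 2\<close> and \<open>j = (r - s) / 2\<close>. The double sum \<open>g\<close> becomes a single sum
  \<open>g(x) = \<Sum> \<alpha>(n) / (1 - x q^n)\<close> over all integers \<open>n\<close>, where \<open>\<alpha>(n)\<close> (called \<open>hcoeff\<close> below) is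
  up to sign \<open>q^(t n (n + 1))\<close> times a finite sum over \<open>j\<close>, and the constants \<open>\<theta>\<close> become the moments
  \<open>\<Sum> \<alpha>(n) q^(k n)\<close>. The finite sums for \<open>n\<close> and \<open>n - 1\<close> differ only in their two end terms
  (\<open>hcoeff_rec\<close>), and \<open>1 - y^(2 t)\<close> is divisible by \<open>1 - y\<close>. Comparing \<open>x^(2 t) g(x)\<close> with \<open>g(q x)\<close>
  therefore leaves the moments and two sums \<open>\<Sum> (-1)^n q^(n (n - 1) / 2 - l n) / (1 - x q^n)\<close>, which are
  multiples of \<open>1 / \<Theta>(x; q)\<close>. The result (\<open>theta_sum_functional_equation\<close>) is
  \[ x^{2t} f(x) + x f(q x) = x^{m+1} + x^{2t-m} - \frac{\Theta(x;q)}{(q)_\infty^3}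
       \sum_{k=0}^{2t-1} x^k q^k \theta_{t+k,m+k}. \]

  Let \<open>G(x) = \<Theta>(-x^(2 t - 1); q^(2 t - 1))\<close>. Since \<open>G(q x) = G(x) / x^(2 t - 1)\<close>, multiplication by
  \<open>x^(-2 t) G(x)\<close> turns the left-hand side into \<open>H(x) + H(q x)\<close> with \<open>H = G f\<close>, and the right-hand side
  becomes an explicit Laurent series \<open>\<Sum> b(N) x^N\<close>. One solution of such an equation is visible:
  \<open>\<Sum> b(N) x^N / (1 + q^N)\<close>. This is where the Appell functions come from: their denominators are
  exactly these \<open>1 + q^N\<close>. The powers \<open>x^(m + 1)\<close> and \<open>x^(2 t - m)\<close> times \<open>G\<close> give the two Appell functions of
  nome \<open>q^(2 t - 1)\<close>. The last term contains \<open>\<Theta>(x; q) G(x)\<close>, and sorting this product by the residue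
  modulo \<open>2 t\<close> of the exponent (\<open>Theta_mult_G\<close>) gives the sum over \<open>s\<close> and the Appell functions of
  nome \<open>q^(2 t)\<close>.

  It remains to see that the solution is unique. The difference \<open>D\<close> of two solutions is holomorphic on
  the punctured plane, because \<open>\<Theta>(x; q)\<close> removes the poles of \<open>g\<close>, and satisfies \<open>D(q x) = - D(x)\<close>.
  Then \<open>D(exp w)\<close> is a bounded entire function, so \<open>D\<close> is constant by Liouville's theorem
  (\<open>quasiperiodic_imp_constant\<close>), and a constant with \<open>D = - D\<close> is zero.

  The same Liouville argument evaluates \<open>\<Sum> (-1)^n q^(n (n + 1) / 2) / (1 - x q^n)\<close>. The Jacobi triple
  product, which makes products and series interchangeable, is obtained from the finite
  \<open>q\<close>-binomial theorem by dominated convergence.\<close>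

section \<open>Triangular numbers and signs\<close>

definition tri :: "int \<Rightarrow> int" where
  "tri n = n * (n - 1) div 2"

lemma two_tri: "2 * tri n = n * (n - 1)"
  unfolding tri_def by simp

lemma tri_add: "tri (a + b) = tri a + tri b + a * b"
  using two_tri[of a] two_tri[of b] two_tri[of "a + b"] by (simp add: algebra_simps)

lemma tri_minus: "tri (- a) = tri a + a"
  using two_tri[of a] two_tri[of "- a"] by (simp add: algebra_simps)

lemma tri_simps [simp]: "tri 0 = 0" "tri 1 = 0" "tri (-1) = 1"
  by (simp_all add: tri_def)

lemma neg_one_powi_cases: "(- 1 :: complex) powi n = (if even n then 1 else - 1)"
  by (cases "n \<ge> 0") (auto simp: power_int_def even_nat_iff uminus_power_if)

lemma norm_neg_one_powi [simp]: "norm ((- 1 :: complex) powi n) = 1"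
  by (simp add: neg_one_powi_cases)

lemma neg_one_powi_mult_uminus:
  "(- 1) powi n * a * (- y) powi n = a * (y :: complex) powi n"
  using power_int_mult_distrib[of "- 1" y n] by (simp add: neg_one_powi_cases)

section \<open>Series over the integers\<close>

lemma summable_gaussian_int:
  fixes \<rho> y :: real
  assumes "0 < \<rho>" "\<rho> < 1" "0 < y"
  shows "(\<lambda>n. \<rho> powi tri n * y powi n) summable_on UNIV"
proof -
  have half: "summable (\<lambda>n::nat. \<rho> powi tri (int n) * z ^ n)" if "z > 0" for z
  proof -
    have "(\<lambda>n. \<rho> ^ n * z) \<longlonglongrightarrow> 0 * z"
      using assms by (intro tendsto_intros LIMSEQ_power_zero) auto
    then have "eventually (\<lambda>n. \<rho> ^ n * z < 1 / 2) sequentially"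
      by (rule order_tendstoD(2)) simp
    then obtain N where N: "\<And>n. n \<ge> N \<Longrightarrow> \<rho> ^ n * z < 1 / 2"
      unfolding eventually_sequentially by auto
    show ?thesis
    proof (rule summable_ratio_test[of "1/2" N])
      fix n :: nat assume "N \<le> n"
      let ?a = "\<lambda>n. \<rho> powi tri (int n) * z ^ n"
      have "?a (Suc n) = (\<rho> ^ n * z) * ?a n"
        using assms that tri_add[of "int n" 1] by (simp add: power_int_add add.commute)
      moreover have "?a n \<ge> 0" using assms that by simp
      ultimately show "norm (?a (Suc n)) \<le> 1 / 2 * norm (?a n)"
        using N[OF \<open>N \<le> n\<close>] assms that
        by (simp add: abs_mult mult_right_mono)
    qed simp
  qed
  let ?f = "\<lambda>n. \<rho> powi tri n * y powi n"
  have pos: "?f n \<ge> 0" for n using assms by simp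
  have "?f summable_on range int"
    using summable_nonneg_imp_summable_on[OF half[of y]] assms
    by (subst summable_on_reindex) (simp_all add: o_def)
  moreover have "?f summable_on range (\<lambda>n. - int n)"
  proof (subst summable_on_reindex)
    show "inj (\<lambda>n. - int n)" by (auto intro: injI)
    have "\<rho> powi tri (- int n) * y powi (- int n) = \<rho> powi tri (int n) * (\<rho> / y) ^ n" for n
      using assms by (simp add: tri_minus power_int_add power_int_minus power_divide field_simps)
    moreover have "(\<lambda>n. \<rho> powi tri (int n) * (\<rho> / y) ^ n) summable_on UNIV"
      using assms by (intro summable_nonneg_imp_summable_on half) auto
    ultimately show "(?f \<circ> (\<lambda>n. - int n)) summable_on UNIV"
      by (simp only: o_def)
  qed
  moreover have "range int \<union> range (\<lambda>n. - int n) = UNIV"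
  proof (rule UNIV_eq_I[symmetric])
    show "n \<in> range int \<union> range (\<lambda>n. - int n)" for n
      by (cases n rule: int_cases2) auto
  qed
  ultimately show ?thesis
    using summable_on_union[of ?f "range int" "range (\<lambda>n. - int n)"] by simp
qed

lemma
  fixes f :: "'k \<Rightarrow> 'n \<Rightarrow> complex"
  assumes "finite A" "\<And>k. k \<in> A \<Longrightarrow> f k summable_on UNIV"
  shows summable_on_finite_sum: "(\<lambda>n. \<Sum>k\<in>A. f k n) summable_on UNIV"
    and infsum_finite_sum: "(\<Sum>\<^sub>\<infinity>n. \<Sum>k\<in>A. f k n) = (\<Sum>k\<in>A. \<Sum>\<^sub>\<infinity>n. f k n)"
proof -
  have "(\<lambda>n. \<Sum>k\<in>A. f k n) summable_on UNIV \<and>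
      (\<Sum>\<^sub>\<infinity>n. \<Sum>k\<in>A. f k n) = (\<Sum>k\<in>A. \<Sum>\<^sub>\<infinity>n. f k n)"
    using assms
  proof (induction rule: finite_induct)
    case (insert k A)
    then have "f k summable_on UNIV" "(\<lambda>n. \<Sum>k\<in>A. f k n) summable_on UNIV" by auto
    with insert show ?case by (simp add: summable_on_add infsum_add)
  qed simp
  then show "(\<lambda>n. \<Sum>k\<in>A. f k n) summable_on UNIV"
    and "(\<Sum>\<^sub>\<infinity>n. \<Sum>k\<in>A. f k n) = (\<Sum>k\<in>A. \<Sum>\<^sub>\<infinity>n. f k n)" by auto
qed

text \<open>Tannery's theorem for unordered sums: the partial sums over finite sets converge uniformly in \<open>n\<close> by
  the Weierstrass M-test, so the two limits may be exchanged.\<close>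
lemma tendsto_infsum_dominated:
  fixes f :: "'a \<Rightarrow> nat \<Rightarrow> complex"
  assumes "\<And>k n. norm (f k n) \<le> M k" "M summable_on UNIV" "\<And>k. (\<lambda>n. f k n) \<longlonglongrightarrow> l k"
  shows "(\<lambda>n. \<Sum>\<^sub>\<infinity>k. f k n) \<longlonglongrightarrow> (\<Sum>\<^sub>\<infinity>k. l k)"
proof (rule swap_uniform_limit')
  show "uniform_limit UNIV (\<lambda>X n. \<Sum>k\<in>X. f k n) (\<lambda>n. \<Sum>\<^sub>\<infinity>k. f k n) (finite_subsets_at_top UNIV)"
    by (rule Weierstrass_m_test_general[where M = M]) (use assms in auto)
  show "\<forall>\<^sub>F X in finite_subsets_at_top UNIV. (\<lambda>n. \<Sum>k\<in>X. f k n) \<longlonglongrightarrow> (\<Sum>k\<in>X. l k)"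
    by (intro always_eventually allI tendsto_sum assms)
  have "norm (l k) \<le> M k" for k
    by (rule LIMSEQ_le_const2[OF tendsto_norm[OF assms(3)]]) (use assms in auto)
  then have "(\<lambda>k. norm (l k)) summable_on UNIV"
    by (rule_tac summable_on_comparison_test[OF assms(2)]) auto
  then have "l summable_on UNIV"
    by (rule abs_summable_summable)
  then show "((\<lambda>X. \<Sum>k\<in>X. l k) \<longlongrightarrow> (\<Sum>\<^sub>\<infinity>k. l k)) (finite_subsets_at_top UNIV)"
    by (rule infsum_tendsto)
qed auto

lemma holomorphic_on_infsum:
  fixes f :: "'a \<Rightarrow> complex \<Rightarrow> complex"
  assumes "open S" and hol: "\<And>n. f n holomorphic_on S"
    and dom: "\<And>z. z \<in> S \<Longrightarrow> \<exists>r>0. \<exists>M. M summable_on UNIV \<and> cball z r \<subseteq> S \<and>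
                (\<forall>n. \<forall>w\<in>cball z r. norm (f n w) \<le> M n)"
  shows "(\<lambda>z. \<Sum>\<^sub>\<infinity>n. f n z) holomorphic_on S"
proof (rule holomorphic_on_open[THEN iffD2, OF \<open>open S\<close>], rule ballI)
  fix z assume "z \<in> S"
  then obtain r M where r: "r > 0" "M summable_on UNIV" "cball z r \<subseteq> S"
      "\<And>n w. w \<in> cball z r \<Longrightarrow> norm (f n w) \<le> M n"
    using dom[of z] by blast
  have "uniform_limit (cball z r) (\<lambda>X w. \<Sum>n\<in>X. f n w) (\<lambda>w. \<Sum>\<^sub>\<infinity>n. f n w) (finite_subsets_at_top UNIV)"
    by (rule Weierstrass_m_test_general[where M = M]) (use r in auto)
  moreover have "(\<lambda>w. \<Sum>n\<in>X. f n w) holomorphic_on S" for X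
    by (intro holomorphic_on_sum hol)
  then have "\<forall>\<^sub>F X in finite_subsets_at_top UNIV. continuous_on (cball z r) (\<lambda>w. \<Sum>n\<in>X. f n w) \<and>
               (\<lambda>w. \<Sum>n\<in>X. f n w) holomorphic_on ball z r"
    using r(3) ball_subset_cball[of z r]
    by (intro always_eventually allI conjI holomorphic_on_imp_continuous_on;
        blast intro: holomorphic_on_subset)
  ultimately have "(\<lambda>w. \<Sum>\<^sub>\<infinity>n. f n w) holomorphic_on ball z r"
    by (rule_tac holomorphic_uniform_limit) auto
  then show "\<exists>f'. ((\<lambda>z. \<Sum>\<^sub>\<infinity>n. f n z) has_field_derivative f') (at z)"
    using r(1) by (meson centre_in_ball holomorphic_on_open open_ball)
qed

text \<open>The coefficient sequences of the Laurent series that converge on the whole punctured plane.\<close>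
definition rapid :: "(int \<Rightarrow> complex) \<Rightarrow> bool" where
  "rapid c \<longleftrightarrow> (\<forall>y>0. (\<lambda>n. norm (c n) * y powi n) summable_on UNIV)"

lemma rapid_summable:
  assumes "rapid c" "x \<noteq> 0"
  shows "(\<lambda>n. c n * x powi n) summable_on UNIV"
  by (rule abs_summable_summable)
     (use assms in \<open>auto simp: rapid_def norm_mult norm_power_int\<close>)

lemma rapid_bounded_mult:
  assumes "rapid c" "\<And>n. norm (d n) \<le> C * norm (c n)"
  shows "rapid d"
  unfolding rapid_def
proof (intro allI impI)
  fix y :: real assume "y > 0"
  then have "(\<lambda>n. C * (norm (c n) * y powi n)) summable_on UNIV"
    using assms by (intro summable_on_cmult_right) (auto simp: rapid_def)
  then show "(\<lambda>n. norm (d n) * y powi n) summable_on UNIV"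
    by (rule summable_on_comparison_test)
       (use assms \<open>y > 0\<close> in \<open>auto simp flip: mult.assoc intro!: mult_right_mono\<close>)
qed

lemma rapid_mult_powi:
  assumes "rapid c" "a \<noteq> 0"
  shows "rapid (\<lambda>n. c n * a powi n)"
  unfolding rapid_def
proof (intro allI impI)
  fix y :: real assume "y > 0"
  with assms have "(\<lambda>n. norm (c n) * (norm a * y) powi n) summable_on UNIV"
    by (auto simp: rapid_def)
  then show "(\<lambda>n. norm (c n * a powi n) * y powi n) summable_on UNIV"
    by (simp add: norm_mult norm_power_int power_int_mult_distrib mult.assoc)
qed

lemma rapid_add:
  assumes "rapid c" "rapid d" shows "rapid (\<lambda>n. c n + d n)"
  unfolding rapid_def
proof (intro allI impI)
  fix y :: real assume y: "y > 0"
  have "(\<lambda>n. norm (c n) * y powi n + norm (d n) * y powi n) summable_on UNIV"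
    using assms y unfolding rapid_def by (intro summable_on_add) blast+
  then show "(\<lambda>n. norm (c n + d n) * y powi n) summable_on UNIV"
  proof (rule summable_on_comparison_test)
    fix n show "norm (c n + d n) * y powi n \<le> norm (c n) * y powi n + norm (d n) * y powi n"
      using y norm_triangle_ineq[of "c n" "d n"]
      by (simp add: mult_right_mono flip: distrib_right)
  qed (use y in simp)
qed

text \<open>An integer power is monotone in its base, increasing or decreasing according to the sign of the
  exponent. This bounds a Laurent series on an annulus by its values on the two boundary circles.\<close>
lemma powi_le_sum_ends:
  fixes y a b :: real
  assumes "0 < a" "a \<le> y" "y \<le> b"
  shows "y powi n \<le> a powi n + b powi n"
proof (cases "n \<ge> 0")
  case True
  then have "y powi n \<le> b powi n" using assms by (intro power_int_mono) auto
  then show ?thesis using assms by (simp add: add_increasing)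
next
  case False
  then have "y powi n \<le> a powi n"
    using assms by (intro power_int_antimono) auto
  then show ?thesis using assms by (simp add: add_increasing2)
qed

lemma holomorphic_on_laurent:
  assumes "rapid c"
  shows "(\<lambda>x. \<Sum>\<^sub>\<infinity>n. c n * x powi n) holomorphic_on - {0}"
proof (rule holomorphic_on_infsum)
  fix z :: complex assume "z \<in> - {0}"
  then have z: "norm z > 0" by auto
  define a where "a = norm z / 2"
  \<comment> \<open>With \<open>a = \<bar>z\<bar> / 2\<close>, the closed disc of radius \<open>a\<close> around \<open>z\<close> lies in the annulus \<open>a \<le> \<bar>w\<bar> \<le> 3 a\<close>.\<close>
  define M where "M = (\<lambda>n. norm (c n) * a powi n + norm (c n) * (3 * a) powi n)"
  have a: "a > 0" using z by (simp add: a_def)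
  have "M summable_on UNIV"
    unfolding M_def
  proof (rule summable_on_add)
    show "(\<lambda>n. norm (c n) * a powi n) summable_on UNIV"
      using assms a unfolding rapid_def by blast
    have "3 * a > 0" using a by simp
    then show "(\<lambda>n. norm (c n) * (3 * a) powi n) summable_on UNIV"
      using assms unfolding rapid_def by blast
  qed
  moreover have *: "a \<le> norm w \<and> norm w \<le> 3 * a" if "w \<in> cball z a" for w
  proof -
    have "norm (z - w) \<le> a" using that by (simp add: dist_norm)
    moreover have "norm z - norm w \<le> norm (z - w)" "norm w - norm z \<le> norm (z - w)"
      using norm_triangle_ineq2[of z w] norm_triangle_ineq2[of w z]
      by (simp_all add: norm_minus_commute)
    moreover have "norm z = 2 * a" by (simp add: a_def)
    ultimately show ?thesis by linarith
  qed
  moreover have "cball z a \<subseteq> - {0}" using *[of 0] a by auto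
  moreover have "norm (c n * w powi n) \<le> M n" if "w \<in> cball z a" for n w
  proof -
    have "norm (c n) * norm w powi n \<le> norm (c n) * (a powi n + (3 * a) powi n)"
      using *[OF that] a by (intro mult_left_mono powi_le_sum_ends) auto
    then show ?thesis
      unfolding M_def norm_mult norm_power_int distrib_left .
  qed
  ultimately show "\<exists>r>0. \<exists>M. M summable_on UNIV \<and> cball z r \<subseteq> - {0} \<and>
                (\<forall>n. \<forall>w\<in>cball z r. norm (c n * w powi n) \<le> M n)"
    using a by blast
next
  fix n
  show "(\<lambda>x. c n * x powi n) holomorphic_on - {0}"
    by (intro holomorphic_intros) simp
qed (simp add: open_Compl)

section \<open>The Jacobi triple product\<close>

locale nome =
  fixes q :: complex
  assumes norm_q_pos: "0 < norm q" and norm_q_less_1: "norm q < 1"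
begin

lemma q_nonzero [simp]: "q \<noteq> 0"
  using norm_q_pos by auto

lemma one_minus_q_power_nonzero: "1 - q * q ^ i \<noteq> 0"
proof
  assume "1 - q * q ^ i = 0"
  then have "norm (q ^ Suc i) = 1" by simp
  moreover have "norm (q ^ Suc i) < 1"
    unfolding norm_power using norm_q_pos norm_q_less_1 by (intro power_Suc_less_one) auto
  ultimately show False by simp
qed

lemma convergent_prod_qpoch: "convergent_prod (\<lambda>i. 1 - x * q ^ i)"
proof (intro abs_convergent_prod_imp_convergent_prod summable_imp_abs_convergent_prod)
  have "summable (\<lambda>i. norm x * norm q ^ i)"
    using norm_q_less_1 by (intro summable_mult summable_geometric) simp
  then show "summable (\<lambda>i. norm (1 - x * q ^ i - 1))"
    by (simp add: norm_mult norm_power)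
qed

lemma has_prod_qpoch: "(\<lambda>i. 1 - x * q ^ i) has_prod qpoch x q"
  using convergent_prod_qpoch convergent_prod_has_prod_iff unfolding qpoch_def by blast

lemma qpoch_LIMSEQ: "(\<lambda>n. \<Prod>i<n. 1 - x * q ^ i) \<longlonglongrightarrow> qpoch x q"
  by (rule has_prod_imp_tendsto'[OF has_prod_qpoch])

lemma qpoch_eq_0_iff: "qpoch x q = 0 \<longleftrightarrow> (\<exists>i. x * q ^ i = 1)"
proof -
  have "qpoch x q = 0 \<longleftrightarrow> (\<exists>i. 0 = 1 - x * q ^ i)"
    using has_prod_eq_0_iff[OF has_prod_qpoch, of x] unfolding image_iff by blast
  also have "\<dots> \<longleftrightarrow> (\<exists>i. x * q ^ i = 1)"
    by (metis right_minus_eq)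
  finally show ?thesis .
qed

lemma qpoch_q_nonzero: "qpoch q q \<noteq> 0"
  using one_minus_q_power_nonzero by (auto simp: qpoch_eq_0_iff)

lemma qpoch_rec: "qpoch x q = (1 - x) * qpoch (x * q) q"
proof (rule LIMSEQ_unique)
  show "(\<lambda>n. \<Prod>i<Suc n. 1 - x * q ^ i) \<longlonglongrightarrow> qpoch x q"
    by (rule LIMSEQ_Suc[OF qpoch_LIMSEQ])
  have "(\<lambda>n. (1 - x) * (\<Prod>i<n. 1 - x * q * q ^ i)) \<longlonglongrightarrow> (1 - x) * qpoch (x * q) q"
    by (intro tendsto_intros qpoch_LIMSEQ)
  then show "(\<lambda>n. \<Prod>i<Suc n. 1 - x * q ^ i) \<longlonglongrightarrow> (1 - x) * qpoch (x * q) q"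
    by (simp only: prod.lessThan_Suc_shift) (simp add: mult.assoc)
qed

text \<open>Used at \<open>x = q\<close> to find the value of \<open>\<Theta>(x; q) / (1 - x)\<close> at its removable singularity.\<close>
lemma isCont_qpoch: "isCont (\<lambda>x. qpoch x q) x"
proof -
  define R where "R = norm x + 1"
  have "uniformly_convergent_on (cball 0 R) (\<lambda>N x. \<Sum>n<N. norm (- (x * q ^ n)))"
  proof (rule Weierstrass_m_test')
    show "norm (norm (- (x * q ^ n))) \<le> R * norm q ^ n" if "x \<in> cball 0 R" for n x
      using that by (auto simp: norm_mult norm_power intro!: mult_right_mono)
    show "summable (\<lambda>n. R * norm q ^ n)"
      using norm_q_less_1 by (intro summable_mult summable_geometric) simp
  qed
  then have "uniformly_convergent_on (cball 0 R) (\<lambda>N x. \<Prod>n<N. 1 + - (x * q ^ n))"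
    by (intro uniformly_convergent_on_prod) (auto intro!: continuous_intros)
  then obtain L where L: "uniform_limit (cball 0 R) (\<lambda>N x. \<Prod>n<N. 1 + - (x * q ^ n)) L sequentially"
    by (auto simp: uniformly_convergent_on_def)
  have "L y = qpoch y q" if "y \<in> cball 0 R" for y
    using LIMSEQ_unique[OF tendsto_uniform_limitI[OF L that]] qpoch_LIMSEQ[of y] by simp
  moreover have "continuous_on (cball 0 R) L"
    by (rule uniform_limit_theorem[OF _ L]) (auto intro!: always_eventually continuous_intros)
  ultimately have "continuous_on (cball 0 R) (\<lambda>x. qpoch x q)"
    using continuous_on_cong[OF refl, of "cball 0 R" L "\<lambda>x. qpoch x q"] by blast
  then show ?thesis
    by (rule continuous_on_interior) (simp add: R_def)
qed

fun gauss_binomial :: "nat \<Rightarrow> nat \<Rightarrow> complex" where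
  "gauss_binomial n 0 = 1"
| "gauss_binomial 0 (Suc k) = 0"
| "gauss_binomial (Suc n) (Suc k) = gauss_binomial n (Suc k) + q ^ (n - k) * gauss_binomial n k"

lemma gauss_binomial_eq_0: "n < k \<Longrightarrow> gauss_binomial n k = 0"
  by (induction n k rule: gauss_binomial.induct) auto

definition qfact :: "nat \<Rightarrow> complex" where
  "qfact n = (\<Prod>i<n. 1 - q * q ^ i)"

lemma qfact_nonzero [simp]: "qfact n \<noteq> 0"
  using one_minus_q_power_nonzero by (simp add: qfact_def)

text \<open>The Pascal-type recursion defines the Gaussian binomials without division; this identity shows that
  they are the usual quotients of \<open>q\<close>-factorials.\<close>
lemma gauss_binomial_qfact:
  "k \<le> n \<Longrightarrow> gauss_binomial n k * qfact k * qfact (n - k) = qfact n"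
proof (induction n k rule: gauss_binomial.induct)
  case (3 n k)
  then have "k \<le> n" by simp
  have IH2: "gauss_binomial n k * qfact k * qfact (n - k) = qfact n"
    using 3 by simp
  have IH1: "gauss_binomial n (Suc k) * qfact (Suc k) * qfact (n - k) = qfact n * (1 - q ^ (n - k))"
  proof (cases "k = n")
    case True
    then show ?thesis by (simp add: gauss_binomial_eq_0)
  next
    case False
    then have "n - k = Suc (n - Suc k)" using \<open>k \<le> n\<close> by simp
    then have "qfact (n - k) = qfact (n - Suc k) * (1 - q ^ (n - k))"
      by (simp add: qfact_def)
    moreover have "gauss_binomial n (Suc k) * qfact (Suc k) * qfact (n - Suc k) = qfact n"
      using 3(1) False \<open>k \<le> n\<close> by simp
    ultimately show ?thesis by (metis mult.assoc)
  qed
  have "gauss_binomial (Suc n) (Suc k) * qfact (Suc k) * qfact (n - k) =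
      gauss_binomial n (Suc k) * qfact (Suc k) * qfact (n - k) +
      q ^ (n - k) * (1 - q * q ^ k) * (gauss_binomial n k * qfact k * qfact (n - k))"
    by (simp add: algebra_simps qfact_def)
  also have "\<dots> = qfact n * (1 - q ^ (n - k) + q ^ (n - k) - q * (q ^ (n - k) * q ^ k))"
    unfolding IH1 IH2 by (simp add: algebra_simps)
  also have "q ^ (n - k) * q ^ k = q ^ n"
    using \<open>k \<le> n\<close> by (simp flip: power_add)
  finally show ?case by (simp add: qfact_def algebra_simps)
qed (auto simp: qfact_def)

lemma q_binomial_theorem:
  "(\<Prod>i<n. 1 - x * q ^ i) = (\<Sum>k\<le>n. (- x) ^ k * q powi tri (int k) * gauss_binomial n k)"
proof (induction n)
  case (Suc n)
  let ?c = "\<lambda>n k. (- x) ^ k * q powi tri (int k) * gauss_binomial n k"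
  have "(- x) ^ Suc k * q powi tri (int (Suc k)) * (q ^ (n - k) * gauss_binomial n k) =
      - x * q ^ n * ?c n k" if "k \<le> n" for k
  proof -
    have "q powi tri (int (Suc k)) * q ^ (n - k) = q powi tri (int k) * (q ^ k * q ^ (n - k))"
      using tri_add[of "int k" 1] by (simp add: power_int_add add.commute)
    also have "q ^ k * q ^ (n - k) = q ^ n"
      using that by (simp flip: power_add)
    finally show ?thesis by (simp add: mult_ac)
  qed
  then have *: "(\<Sum>k\<le>n. (- x) ^ Suc k * q powi tri (int (Suc k)) * (q ^ (n - k) * gauss_binomial n k)) =
     - x * q ^ n * (\<Sum>k\<le>n. ?c n k)"
    unfolding sum_distrib_left by (intro sum.cong) auto
  have "(\<Sum>k\<le>Suc n. ?c (Suc n) k) = ?c (Suc n) 0 + (\<Sum>k\<le>n. ?c (Suc n) (Suc k))"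
    by (rule sum.atMost_Suc_shift)
  also have "(\<Sum>k\<le>n. ?c (Suc n) (Suc k)) = (\<Sum>k\<le>n. ?c n (Suc k)) +
      (\<Sum>k\<le>n. (- x) ^ Suc k * q powi tri (int (Suc k)) * (q ^ (n - k) * gauss_binomial n k))"
    by (simp only: gauss_binomial.simps distrib_left sum.distrib)
  also note *
  also have "?c (Suc n) 0 + ((\<Sum>k\<le>n. ?c n (Suc k)) + - x * q ^ n * (\<Sum>k\<le>n. ?c n k)) =
      (\<Sum>k\<le>Suc n. ?c n k) + - x * q ^ n * (\<Sum>k\<le>n. ?c n k)"
    by (subst sum.atMost_Suc_shift) simp
  also have "(\<Sum>k\<le>Suc n. ?c n k) = (\<Sum>k\<le>n. ?c n k)"
    unfolding sum.atMost_Suc by (subst gauss_binomial_eq_0) simp_all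
  also have "(\<Sum>k\<le>n. ?c n k) + - x * q ^ n * (\<Sum>k\<le>n. ?c n k) =
      (\<Sum>k\<le>n. ?c n k) * (1 - x * q ^ n)"
    by (simp only: ring_distribs) simp
  finally show ?case
    unfolding prod.lessThan_Suc Suc.IH ..
qed simp

text \<open>Replace \<open>n\<close> by \<open>2 n\<close> and \<open>x\<close> by \<open>y = x q^(-n)\<close> in the \<open>q\<close>-binomial theorem. The upper half of the product
  is then the first product below. In the lower half, pulling \<open>- x / q^(i + 1)\<close> out of every factor
  gives the second product.\<close>
lemma q_binomial_centred:
  assumes "x \<noteq> 0"
  shows "(\<Prod>i<n. 1 - x * q ^ i) * (\<Prod>i<n. 1 - q / x * q ^ i) =
    (\<Sum>m\<in>{- int n..int n}. (- x) powi m * q powi tri m * gauss_binomial (2 * n) (nat (m + int n)))"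
proof -
  define y where "y = x * q powi (- int n)"
  define C where "C = (- x) powi int n * q powi (- tri (- int n))"
  have prod_lower: "(\<Prod>i<n. 1 - y * q ^ i) = C * (\<Prod>i<n. 1 - q / x * q ^ i)"
  proof -
    have "(\<Prod>i<n. 1 - y * q ^ i) = (\<Prod>i<n. 1 - y * q ^ (n - Suc i))"
      by (rule prod.nat_diff_reindex[symmetric])
    also have "\<dots> = (\<Prod>i<n. (- x / q ^ Suc i) * (1 - q / x * q ^ i))"
    proof (rule prod.cong[OF refl])
      fix i assume "i \<in> {..<n}"
      then have "q ^ n = q ^ (n - Suc i) * q ^ Suc i"
        by (simp only: power_add[symmetric]) simp
      then show "1 - y * q ^ (n - Suc i) = (- x / q ^ Suc i) * (1 - q / x * q ^ i)"
        using assms unfolding y_def by (simp add: power_int_minus field_simps)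
    qed
    also have "\<dots> = (\<Prod>i<n. - x / q ^ Suc i) * (\<Prod>i<n. 1 - q / x * q ^ i)"
      by (rule prod.distrib)
    also have "(\<Prod>i<n. - x / q ^ Suc i) = C"
    proof -
      have "(\<Prod>i<n. - x / q ^ Suc i) = (- x) ^ n * q powi (- tri (- int n))" for n
      proof (induction n)
        case (Suc n)
        have "tri (- int (Suc n)) = tri (- int n) + int n + 1"
          using tri_add[of "- int n" "-1"] by (simp add: algebra_simps)
        then have "q powi (- tri (- int (Suc n))) = q powi (- tri (- int n)) / q ^ Suc n"
          by (simp add: power_int_diff power_int_add power_int_minus field_simps)
        then show ?case using Suc by simp
      qed simp
      then show ?thesis by (simp add: C_def)
    qed
    finally show ?thesis .
  qed
  have upper: "(\<Prod>i<n. 1 - y * q ^ (n + i)) = (\<Prod>i<n. 1 - x * q ^ i)"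
    by (simp add: y_def power_add power_int_minus field_simps)
  have C: "C \<noteq> 0" using assms by (simp add: C_def)
  have "(\<Prod>i<2 * n. 1 - y * q ^ i) = (\<Prod>i<n. 1 - y * q ^ i) * (\<Prod>i<n. 1 - y * q ^ (n + i))"
    using prod.atLeastLessThan_concat[of 0 n "2 * n" "\<lambda>i. 1 - y * q ^ i"]
      prod.shift_bounds_nat_ivl[of "\<lambda>i. 1 - y * q ^ i" 0 n n]
    by (simp add: lessThan_atLeast0 mult_2 add.commute)
  then have "C * ((\<Prod>i<n. 1 - x * q ^ i) * (\<Prod>i<n. 1 - q / x * q ^ i)) =
      (\<Sum>k\<le>2 * n. (- y) ^ k * q powi tri (int k) * gauss_binomial (2 * n) k)"
    unfolding q_binomial_theorem[symmetric] prod_lower upper by (simp add: mult_ac)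
  also have "\<dots> = (\<Sum>m\<in>{- int n..int n}. (- y) powi (m + int n) * q powi tri (m + int n) *
        gauss_binomial (2 * n) (nat (m + int n)))"
    by (rule sum.reindex_bij_witness[of _ "\<lambda>m. nat (m + int n)" "\<lambda>k. int k - int n"]) auto
  also have "\<dots> = (\<Sum>m\<in>{- int n..int n}. C * ((- x) powi m * q powi tri m *
        gauss_binomial (2 * n) (nat (m + int n))))"
  proof (rule sum.cong[OF refl])
    fix m
    have "- int n * (m + int n) + tri (m + int n) = tri m - tri (- int n)"
      using two_tri[of "int n"] by (simp add: tri_add tri_minus algebra_simps)
    then have "q powi (- int n * (m + int n)) * q powi tri (m + int n) =
        q powi tri m * q powi (- tri (- int n))"
      by (simp flip: power_int_add)
    moreover have "(- y) powi (m + int n) = (- x) powi (m + int n) * q powi (- int n * (m + int n))"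
      using power_int_mult_distrib[of "- x" "q powi (- int n)" "m + int n"]
        power_int_mult[of q "- int n" "m + int n"]
      by (simp add: y_def)
    moreover have "(- x) powi (m + int n) = (- x) powi m * (- x) powi int n"
      using assms by (subst power_int_add) auto
    ultimately show "(- y) powi (m + int n) * q powi tri (m + int n) *
        gauss_binomial (2 * n) (nat (m + int n)) =
      C * ((- x) powi m * q powi tri m * gauss_binomial (2 * n) (nat (m + int n)))"
      by (simp add: C_def mult_ac)
  qed
  finally show ?thesis using C by (simp flip: sum_distrib_left)
qed

lemma qfact_LIMSEQ: "qfact \<longlonglongrightarrow> qpoch q q"
  using qpoch_LIMSEQ[of q] by (simp add: qfact_def[abs_def])

text \<open>The \<open>q\<close>-factorials converge to \<open>(q; q)\<close>, which is nonzero; so they and their inverses are bounded.\<close>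
lemma gauss_binomial_bounded: "\<exists>M. \<forall>n k. norm (gauss_binomial n k) \<le> M"
proof -
  obtain A where A: "\<And>n. norm (qfact n) \<le> A"
    using convergent_imp_Bseq[OF convergentI[OF qfact_LIMSEQ]] by (auto simp: Bseq_def)
  have "(\<lambda>n. inverse (qfact n)) \<longlonglongrightarrow> inverse (qpoch q q)"
    by (intro tendsto_inverse qfact_LIMSEQ qpoch_q_nonzero)
  from convergent_imp_Bseq[OF convergentI[OF this]]
  obtain B where B: "\<And>n. norm (inverse (qfact n)) \<le> B" unfolding Bseq_def by blast
  have A0: "0 \<le> A" and B0: "0 \<le> B"
    using A[of 0] B[of 0] norm_ge_zero order_trans by blast+
  have "norm (gauss_binomial n k) \<le> A * B * B" for n k
  proof (cases "k \<le> n")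
    case True
    then have "gauss_binomial n k = qfact n * inverse (qfact k) * inverse (qfact (n - k))"
      using gauss_binomial_qfact[OF True] by (simp add: field_simps)
    also have "norm \<dots> \<le> A * B * B"
      unfolding norm_mult using A B A0 B0 by (intro mult_mono mult_nonneg_nonneg) auto
    finally show ?thesis .
  qed (use A0 B0 in \<open>simp add: gauss_binomial_eq_0\<close>)
  then show ?thesis by blast
qed

lemma gauss_binomial_LIMSEQ:
  "(\<lambda>n. gauss_binomial (2 * n) (nat (m + int n))) \<longlonglongrightarrow> 1 / qpoch q q"
proof -
  have *: "filterlim (\<lambda>n. nat (int n + c)) at_top sequentially" for c
    unfolding filterlim_at_top
  proof
    fix Z :: nat
    show "\<forall>\<^sub>F n in sequentially. Z \<le> nat (int n + c)"
      using eventually_ge_at_top[of "nat (int Z - c)"] by eventually_elim auto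
  qed
  have "(\<lambda>n. qfact (2 * n) / (qfact (nat (int n + m)) * qfact (nat (int n + - m))))
      \<longlonglongrightarrow> qpoch q q / (qpoch q q * qpoch q q)"
    using qpoch_q_nonzero
    by (intro tendsto_intros filterlim_compose[OF qfact_LIMSEQ] *) 
       (auto intro!: filterlim_subseq strict_monoI)
  moreover have "\<forall>\<^sub>F n in sequentially. qfact (2 * n) / (qfact (nat (int n + m)) * qfact (nat (int n + - m))) =
      gauss_binomial (2 * n) (nat (m + int n))"
    using eventually_ge_at_top[of "nat \<bar>m\<bar>"]
  proof eventually_elim
    case (elim n)
    then have "nat (m + int n) \<le> 2 * n" "2 * n - nat (m + int n) = nat (int n + - m)" by auto
    with gauss_binomial_qfact[of "nat (m + int n)" "2 * n"] show ?case
      by (simp add: field_simps)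
  qed
  ultimately show ?thesis
    using qpoch_q_nonzero by (simp add: tendsto_cong)
qed

lemma rapid_theta: "rapid (\<lambda>n. (- 1) powi n * q powi tri n)"
  using summable_gaussian_int[OF norm_q_pos norm_q_less_1]
  by (simp add: rapid_def norm_mult norm_power_int)

lemma rapid_theta_linear: "rapid (\<lambda>n. (- 1) powi n * q powi (tri n + l * n))"
  using rapid_mult_powi[OF rapid_theta, of "q powi l"]
  by (simp add: power_int_add power_int_mult mult.assoc)

text \<open>The limit \<open>n \<longlonglongrightarrow> \<infinity>\<close> of \<open>q_binomial_centred\<close>. Every coefficient tends to \<open>1 / (q; q)\<close>, and the uniform
  bound on the Gaussian binomials allows the limit to be taken term by term.\<close>
lemma Jacobi_triple_product:
  assumes "x \<noteq> 0"
  shows "Theta x q = (\<Sum>\<^sub>\<infinity>n. (- 1) powi n * q powi tri n * x powi n)"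
proof -
  define u where "u = (\<lambda>n. (- 1) powi n * q powi tri n * x powi n)"
  \<comment> \<open>The finite identities, written as sums over all integers with coefficients padded by \<open>0\<close>.\<close>
  define w where "w = (\<lambda>m n. if \<bar>m\<bar> \<le> int n then gauss_binomial (2 * n) (nat (m + int n)) else 0)"
  obtain M where M: "\<And>n k. norm (gauss_binomial n k) \<le> M"
    using gauss_binomial_bounded by blast
  have u: "u summable_on UNIV"
    unfolding u_def by (rule rapid_summable[OF rapid_theta assms])
  have "(\<lambda>n. \<Sum>\<^sub>\<infinity>m. u m * w m n) \<longlonglongrightarrow> (\<Sum>\<^sub>\<infinity>m. u m * (1 / qpoch q q))"
  proof (rule tendsto_infsum_dominated)
    show "(\<lambda>m. norm (u m) * M) summable_on UNIV"
      using u by (intro summable_on_cmult_left) (simp add: summable_on_iff_abs_summable_on_complex)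
    have "0 \<le> M" using M[of 0 0] norm_ge_zero order_trans by blast
    then have "norm (w m n) \<le> M" for m n
      using M by (simp add: w_def)
    then show "norm (u m * w m n) \<le> norm (u m) * M" for m n
      by (simp add: norm_mult mult_left_mono)
    have "w m \<longlonglongrightarrow> 1 / qpoch q q" for m
    proof (rule Lim_transform_eventually[OF gauss_binomial_LIMSEQ])
      show "\<forall>\<^sub>F n in sequentially. gauss_binomial (2 * n) (nat (m + int n)) = w m n"
        using eventually_ge_at_top[of "nat \<bar>m\<bar>"] by eventually_elim (auto simp: w_def)
    qed
    then show "(\<lambda>n. u m * w m n) \<longlonglongrightarrow> u m * (1 / qpoch q q)" for m
      by (intro tendsto_intros)
  qed
  also have "(\<lambda>n. \<Sum>\<^sub>\<infinity>m. u m * w m n) = (\<lambda>n. (\<Prod>i<n. 1 - x * q ^ i) * (\<Prod>i<n. 1 - q / x * q ^ i))"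
  proof
    fix n
    have "(\<Sum>\<^sub>\<infinity>m. u m * w m n) = (\<Sum>\<^sub>\<infinity>m\<in>{- int n..int n}. u m * w m n)"
      by (rule infsum_cong_neutral) (auto simp: w_def)
    also have "\<dots> = (\<Sum>m\<in>{- int n..int n}. u m * w m n)"
      by simp
    also have "\<dots> = (\<Sum>m\<in>{- int n..int n}. (- x) powi m * q powi tri m *
        gauss_binomial (2 * n) (nat (m + int n)))"
      using power_int_mult_distrib[of "- 1" x]
      by (intro sum.cong) (auto simp: u_def w_def)
    finally show "(\<Sum>\<^sub>\<infinity>m. u m * w m n) = (\<Prod>i<n. 1 - x * q ^ i) * (\<Prod>i<n. 1 - q / x * q ^ i)"
      using q_binomial_centred[OF assms] by simp
  qed
  finally have "(\<lambda>n. (\<Prod>i<n. 1 - x * q ^ i) * (\<Prod>i<n. 1 - q / x * q ^ i)) \<longlonglongrightarrow>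
      infsum u UNIV * (1 / qpoch q q)"
    by (simp only: infsum_cmult_left')
  moreover have "(\<lambda>n. (\<Prod>i<n. 1 - x * q ^ i) * (\<Prod>i<n. 1 - q / x * q ^ i)) \<longlonglongrightarrow>
      qpoch x q * qpoch (q / x) q"
    by (intro tendsto_intros qpoch_LIMSEQ)
  ultimately have "qpoch x q * qpoch (q / x) q = infsum u UNIV * (1 / qpoch q q)"
    by (rule LIMSEQ_unique[rotated])
  then show ?thesis
    using qpoch_q_nonzero by (simp add: Theta_def u_def field_simps)
qed

end

section \<open>Theta functions on the punctured plane\<close>

context nome
begin

text \<open>Reindexing of the theta series with \<open>k \<mapsto> k + n\<close>, since the exponents satisfy
  \<open>tri (k + n) = tri k + tri n + k n\<close>.\<close>
lemma Theta_shift: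
  assumes "x \<noteq> 0"
  shows "Theta (q powi n * x) q = (- 1) powi n * q powi (- tri n) * x powi (- n) * Theta x q"
proof -
  define u where "u = (\<lambda>n. (- 1) powi n * q powi tri n * x powi n)"
  define C where "C = (- 1) powi n * q powi (- tri n) * x powi (- n)"
  have "(- 1) powi k * q powi tri k * (q powi n * x) powi k = C * u (k + n)" for k
  proof -
    have "q powi tri k * q powi (n * k) = q powi (- tri n) * q powi (tri (k + n))"
      by (simp add: tri_add mult.commute flip: power_int_add)
    moreover have "x powi k = x powi (- n) * x powi (k + n)"
      using assms by (simp flip: power_int_add)
    moreover have "(- 1 :: complex) powi k = (- 1) powi n * (- 1) powi (k + n)"
      by (auto simp: neg_one_powi_cases)
    ultimately show ?thesis
      by (simp add: C_def u_def power_int_mult_distrib power_int_mult[symmetric] mult_ac)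
  qed
  then have "Theta (q powi n * x) q = C * (\<Sum>\<^sub>\<infinity>k. u (k + n))"
    using assms by (subst Jacobi_triple_product) (simp_all add: infsum_cmult_right')
  also have "(\<Sum>\<^sub>\<infinity>k. u (k + n)) = infsum u UNIV"
    by (rule infsum_reindex_bij_betw) (rule bij_plus_right)
  finally show ?thesis
    using Jacobi_triple_product[OF assms] by (simp add: C_def u_def)
qed

lemma Theta_q_mult: "x \<noteq> 0 \<Longrightarrow> Theta (q * x) q = - Theta x q / x"
  using Theta_shift[of x 1] by (simp add: power_int_minus field_simps)

lemma Theta_1: "Theta 1 q = 0"
proof -
  have "qpoch 1 q = 0" unfolding qpoch_eq_0_iff by (rule exI[of _ 0]) simp
  then show ?thesis by (simp add: Theta_def)
qed

lemma Theta_powi_eq_0: "Theta (q powi n) q = 0"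
  using Theta_shift[of 1 n] Theta_1 by simp

lemma Theta_nonzero:
  assumes "x \<noteq> 0" "\<And>n. x \<noteq> q powi n"
  shows "Theta x q \<noteq> 0"
proof -
  have "x * q ^ i \<noteq> 1" for i
    using assms(2)[of "- int i"] by (auto simp: power_int_minus field_simps)
  moreover have "q / x * q ^ i \<noteq> 1" for i
    using assms(1) assms(2)[of "int (Suc i)"] unfolding power_int_of_nat
    by (auto simp: field_simps)
  ultimately show ?thesis
    using qpoch_q_nonzero by (auto simp: Theta_def qpoch_eq_0_iff)
qed

text \<open>The series is \<open>\<Theta>(q^l; q)\<close>, and all powers of \<open>q\<close> are zeros of \<open>\<Theta>\<close>.\<close>
lemma infsum_theta_eq_0: "(\<Sum>\<^sub>\<infinity>n. (- 1) powi n * q powi (tri n + l * n)) = 0"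
  using Jacobi_triple_product[of "q powi l"] Theta_powi_eq_0[of l]
  by (simp add: power_int_add power_int_mult mult.assoc)

lemma holomorphic_Theta: "(\<lambda>x. Theta x q) holomorphic_on - {0}"
  using holomorphic_on_laurent[OF rapid_theta]
  by (rule holomorphic_transform) (simp add: Jacobi_triple_product)

text \<open>On an annulus, \<open>w q^n\<close> tends uniformly to \<open>0\<close> as \<open>n \<longlonglongrightarrow> \<infinity>\<close> and to \<open>\<infinity>\<close> as \<open>n \<longlonglongrightarrow> - \<infinity>\<close>. Only
  finitely many of the denominators \<open>1 - w q^n\<close> can therefore be small there.\<close>
lemma one_minus_powi_large:
  assumes "0 < a" "a \<le> b"
  shows "\<exists>K. \<forall>n w. K < \<bar>n\<bar> \<longrightarrow> a \<le> norm w \<longrightarrow> norm w \<le> b \<longrightarrow> 1 / 2 \<le> norm (1 - w * q powi n)"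
proof -
  have lim: "(\<lambda>n. norm q ^ n) \<longlonglongrightarrow> 0"
    using norm_q_less_1 by (intro LIMSEQ_power_zero) auto
  have "\<forall>\<^sub>F n in sequentially. norm q ^ n < min (1 / (2 * b)) (a / 2)"
    using assms by (intro order_tendstoD(2)[OF lim]) auto
  then obtain K where K: "\<And>n. n \<ge> K \<Longrightarrow> norm q ^ n < min (1 / (2 * b)) (a / 2)"
    unfolding eventually_sequentially by blast
  have "1 / 2 \<le> norm (1 - w * q powi n)"
    if n: "int K < \<bar>n\<bar>" and w: "a \<le> norm w" "norm w \<le> b" for n w
  proof (cases "n \<ge> 0")
    case True
    then obtain k where k: "n = int k" by (metis nonneg_int_cases)
    have "norm w * norm q ^ k \<le> b * (1 / (2 * b))"
      using K[of k] n w assms unfolding k by (intro mult_mono) auto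
    then have "norm (w * q powi n) \<le> 1 / 2"
      using assms by (simp add: k norm_mult norm_power)
    then show ?thesis
      using norm_triangle_ineq2[of 1 "w * q powi n"] by simp
  next
    case False
    then obtain k where k: "n = - int k" by (metis int_cases2 linear of_nat_0_le_iff)
    have "norm q ^ k * 2 \<le> norm w"
      using K[of k] n w unfolding k by auto
    then have "2 \<le> norm w / norm q ^ k"
      using norm_q_pos by (simp add: field_simps)
    then have "2 \<le> norm (w * q powi n)"
      by (simp add: k power_int_minus norm_mult norm_inverse norm_power divide_inverse)
    then show ?thesis
      using norm_triangle_ineq2[of "w * q powi n" 1] by (simp add: norm_minus_commute)
  qed
  then show ?thesis by blast
qed

lemma rapid_divide_one_minus:
  assumes "rapid c" "x \<noteq> 0" "\<And>n. x \<noteq> q powi n"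
  shows "rapid (\<lambda>n. c n / (1 - x * q powi n))"
proof -
  obtain K where K: "\<And>n. K < \<bar>n\<bar> \<Longrightarrow> 1 / 2 \<le> norm (1 - x * q powi n)"
    using one_minus_powi_large[of "norm x" "norm x"] assms(2) by auto
  define C where "C = 2 + (\<Sum>n\<in>{-K..K}. norm (1 / (1 - x * q powi n)))"
  have "norm (1 / (1 - x * q powi n)) \<le> C" for n
  proof (cases "K < \<bar>n\<bar>")
    case True
    then have "norm (1 / (1 - x * q powi n)) \<le> 1 / (1 / 2)"
      using K[of n] unfolding norm_divide norm_one by (intro frac_le) auto
    moreover have "(\<Sum>n\<in>{-K..K}. norm (1 / (1 - x * q powi n))) \<ge> 0"
      by (intro sum_nonneg) simp
    ultimately show ?thesis by (simp add: C_def)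
  next
    case False
    then have "norm (1 / (1 - x * q powi n)) \<le> (\<Sum>n\<in>{-K..K}. norm (1 / (1 - x * q powi n)))"
      by (intro member_le_sum) auto
    then show ?thesis by (simp add: C_def)
  qed
  then have "norm (c n / (1 - x * q powi n)) \<le> C * norm (c n)" for n
    using mult_right_mono[of "norm (1 / (1 - x * q powi n))" C "norm (c n)"]
    by (simp add: norm_divide)
  then show ?thesis
    by (rule rapid_bounded_mult[OF assms(1)])
qed

text \<open>The function \<open>\<Theta>(x; q) / (1 - x q^n)\<close>, with its removable singularity at \<open>x = q^(-n)\<close> filled in.\<close>
definition theta_quot :: "int \<Rightarrow> complex \<Rightarrow> complex" where
  "theta_quot n x = - (q powi (- n)) *
     (if x = q powi (- n) then deriv (\<lambda>x. Theta x q) (q powi (- n))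
      else Theta x q / (x - q powi (- n)))"

lemma theta_quot_eq:
  assumes "x \<noteq> q powi (- n)"
  shows "theta_quot n x = Theta x q / (1 - x * q powi n)"
proof -
  have "x * q powi n \<noteq> 1"
    using assms by (auto simp: power_int_minus field_simps)
  moreover have "1 - x * q powi n = - (q powi n) * (x - q powi (- n))"
    by (simp add: power_int_minus field_simps)
  moreover have "- (q powi (- n)) = 1 / - (q powi n)"
    by (simp add: power_int_minus field_simps)
  ultimately show ?thesis
    using assms unfolding theta_quot_def by simp
qed

lemma holomorphic_theta_quot: "theta_quot n holomorphic_on - {0}"
proof -
  let ?a = "q powi (- n)"
  let ?f = "\<lambda>x. if x = ?a then deriv (\<lambda>x. Theta x q) ?a else Theta x q / (x - ?a)"
  have "?f holomorphic_on - {0}"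
    by (rule pole_theorem_open_0[OF holomorphic_Theta, of ?a])
       (auto simp: Theta_powi_eq_0)
  then show ?thesis
    unfolding theta_quot_def[abs_def] by (intro holomorphic_intros)
qed

text \<open>By continuity it suffices to compute a limit, and \<open>\<Theta>(x; q) / (1 - x)\<close> is the product of
  \<open>(x q; q)\<close>, \<open>(q / x; q)\<close> and \<open>(q; q)\<close>, each of which tends to \<open>(q; q)\<close> as \<open>x \<longlonglongrightarrow> 1\<close>.\<close>
lemma theta_quot_0_1: "theta_quot 0 1 = qpoch q q ^ 3"
proof (rule tendsto_unique)
  have "isCont (theta_quot 0) 1"
    using holomorphic_on_imp_continuous_on[OF holomorphic_theta_quot]
    by (simp add: continuous_on_eq_continuous_at open_Compl)
  then show "(theta_quot 0 \<longlongrightarrow> theta_quot 0 1) (at 1)"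
    by (simp add: isCont_def)
  have "((\<lambda>x. qpoch (x * q) q * qpoch (q / x) q * qpoch q q) \<longlongrightarrow>
      qpoch (1 * q) q * qpoch (q / 1) q * qpoch q q) (at (1 :: complex))"
    by (intro tendsto_intros isCont_tendsto_compose[OF isCont_qpoch]) auto
  moreover have "\<forall>\<^sub>F x in at (1 :: complex). qpoch (x * q) q * qpoch (q / x) q * qpoch q q = theta_quot 0 x"
    unfolding eventually_at_filter
  proof (intro always_eventually allI impI)
    fix x :: complex assume "x \<noteq> 1"
    then show "qpoch (x * q) q * qpoch (q / x) q * qpoch q q = theta_quot 0 x"
      using qpoch_rec[of x] by (simp add: theta_quot_eq Theta_def)
  qed
  ultimately show "(theta_quot 0 \<longlongrightarrow> qpoch q q ^ 3) (at 1)"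
    by (simp add: tendsto_cong power3_eq_cube)
qed simp

lemma theta_quot_1_eq_0: "n \<noteq> 0 \<Longrightarrow> theta_quot n 1 = 0"
proof -
  assume "n \<noteq> 0"
  then have "norm q powi (- n) \<noteq> 1"
    using power_int_strict_decreasing[of "- n" 0 "norm q"] power_int_strict_decreasing[of 0 "- n" "norm q"]
      norm_q_pos norm_q_less_1
    by (cases "n > 0") auto
  then have "1 \<noteq> q powi (- n)"
    by (metis norm_one norm_power_int)
  then show ?thesis
    by (simp add: theta_quot_eq Theta_1)
qed

text \<open>The holomorphic form of \<open>\<Theta>(x; q) (\<Sum> \<alpha>(n) / (1 - x q^n))\<close>: every pole of the partial fraction series
  is cancelled inside its own summand.\<close>
definition theta_sum :: "(int \<Rightarrow> complex) \<Rightarrow> complex \<Rightarrow> complex" where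
  "theta_sum \<alpha> x = (\<Sum>\<^sub>\<infinity>n. \<alpha> n * theta_quot n x)"

lemma theta_sum_eq:
  assumes "\<And>n. x \<noteq> q powi n"
  shows "theta_sum \<alpha> x = Theta x q * (\<Sum>\<^sub>\<infinity>n. \<alpha> n / (1 - x * q powi n))"
  unfolding theta_sum_def infsum_cmult_right'[symmetric]
  by (rule infsum_cong) (use assms in \<open>simp add: theta_quot_eq\<close>)

lemma theta_sum_1: "theta_sum \<alpha> 1 = \<alpha> 0 * qpoch q q ^ 3"
proof -
  have "theta_sum \<alpha> 1 = (\<Sum>\<^sub>\<infinity>n\<in>{0}. \<alpha> n * theta_quot n 1)"
    unfolding theta_sum_def by (rule infsum_cong_neutral) (auto simp: theta_quot_1_eq_0)
  then show ?thesis by (simp add: theta_quot_0_1)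
qed

text \<open>Near a given point the functions \<open>theta_quot n\<close> are bounded uniformly in \<open>n\<close>: for large \<open>\<bar>n\<bar>\<close> the
  denominator is at least \<open>1 / 2\<close> in modulus, and the finitely many others are continuous. So a summable
  \<open>\<alpha>\<close> dominates the series.\<close>
lemma holomorphic_theta_sum:
  assumes "\<alpha> summable_on UNIV"
  shows "theta_sum \<alpha> holomorphic_on - {0}"
  unfolding theta_sum_def[abs_def]
proof (rule holomorphic_on_infsum)
  show "open (- {0} :: complex set)" by (simp add: open_Compl)
  show "(\<lambda>x. \<alpha> n * theta_quot n x) holomorphic_on - {0}" for n
    by (intro holomorphic_intros holomorphic_theta_quot)
  fix z :: complex assume "z \<in> - {0}"
  define a where "a = norm z / 2"
  have a: "a > 0" using \<open>z \<in> - {0}\<close> by (simp add: a_def)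
  have *: "a \<le> norm w \<and> norm w \<le> 3 * a" if "w \<in> cball z a" for w
  proof -
    have "norm (z - w) \<le> a" using that by (simp add: dist_norm)
    moreover have "norm z - norm w \<le> norm (z - w)" "norm w - norm z \<le> norm (z - w)"
      using norm_triangle_ineq2[of z w] norm_triangle_ineq2[of w z]
      by (simp_all add: norm_minus_commute)
    moreover have "norm z = 2 * a" by (simp add: a_def)
    ultimately show ?thesis by linarith
  qed
  have sub: "cball z a \<subseteq> - {0}" using *[of 0] a by auto
  have bdd: "\<exists>B. \<forall>w\<in>cball z a. norm (f w) \<le> B" if "f holomorphic_on - {0}" for f :: "complex \<Rightarrow> complex"
  proof -
    have "compact (f ` cball z a)"
      using sub that
      by (intro compact_continuous_image compact_cball)
         (blast intro: holomorphic_on_imp_continuous_on holomorphic_on_subset)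
    then show ?thesis
      by (auto dest!: compact_imp_bounded simp: bounded_iff)
  qed
  have "\<forall>n. \<exists>B. \<forall>w\<in>cball z a. norm (theta_quot n w) \<le> B"
    using bdd[OF holomorphic_theta_quot] by blast
  then obtain B where B: "\<And>n w. w \<in> cball z a \<Longrightarrow> norm (theta_quot n w) \<le> B n"
    by metis
  have B0: "B n \<ge> 0" for n
    by (rule order_trans[OF norm_ge_zero B[of z n]]) (use a in simp)
  obtain T where T: "\<And>w. w \<in> cball z a \<Longrightarrow> norm (Theta w q) \<le> T"
    using bdd[OF holomorphic_Theta] by blast
  have T0: "T \<ge> 0"
    by (rule order_trans[OF norm_ge_zero T[of z]]) (use a in simp)
  obtain K where K: "\<And>n w. K < \<bar>n\<bar> \<Longrightarrow> w \<in> cball z a \<Longrightarrow> 1 / 2 \<le> norm (1 - w * q powi n)"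
    using one_minus_powi_large[of a "3 * a"] a * by force
  define C where "C = 2 * T + (\<Sum>n\<in>{-K..K}. B n)"
  have C: "norm (theta_quot n w) \<le> C" if w: "w \<in> cball z a" for n w
  proof (cases "K < \<bar>n\<bar>")
    case True
    have d: "1 / 2 \<le> norm (1 - w * q powi n)" by (rule K[OF True w])
    then have "w \<noteq> q powi (- n)" by (auto simp: power_int_minus)
    then have "norm (theta_quot n w) = norm (Theta w q) / norm (1 - w * q powi n)"
      by (simp add: theta_quot_eq norm_divide)
    also have "\<dots> \<le> T / (1 / 2)"
      by (rule frac_le) (use d T[OF w] T0 in auto)
    also have "\<dots> \<le> C"
      using B0 by (simp add: C_def sum_nonneg)
    finally show ?thesis .
  next
    case False
    then have "B n \<le> (\<Sum>n\<in>{-K..K}. B n)"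
      using B0 by (intro member_le_sum) auto
    then show ?thesis using B[OF w, of n] T0 by (simp add: C_def)
  qed
  have "(\<lambda>n. norm (\<alpha> n) * C) summable_on UNIV"
    using assms by (intro summable_on_cmult_left) (simp add: summable_on_iff_abs_summable_on_complex)
  moreover have "\<forall>n. \<forall>w\<in>cball z a. norm (\<alpha> n * theta_quot n w) \<le> norm (\<alpha> n) * C"
    using C by (simp add: norm_mult mult_left_mono)
  ultimately show "\<exists>r>0. \<exists>M. M summable_on UNIV \<and> cball z r \<subseteq> - {0} \<and>
      (\<forall>n. \<forall>w\<in>cball z r. norm (\<alpha> n * theta_quot n w) \<le> M n)"
    using a sub by blast
qed

lemma fundamental_annulus:
  assumes "x \<noteq> 0"
  obtains n where "norm q \<le> norm (q powi n * x)" "norm (q powi n * x) \<le> 1"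
proof -
  define l where "l = - ln (norm q)"
  have l: "l > 0" using norm_q_pos norm_q_less_1 by (simp add: l_def)
  define n where "n = \<lceil>ln (norm x) / l\<rceil>"
  have n: "of_int n * l \<ge> ln (norm x)" "(of_int n - 1) * l < ln (norm x)"
    using l ceiling_correct[of "ln (norm x) / l"] unfolding n_def
    by (simp_all only: pos_divide_le_eq pos_less_divide_eq)
  have ln_eq: "ln (norm (q powi n * x)) = ln (norm x) - of_int n * l"
    using assms by (simp add: norm_mult norm_power_int ln_mult ln_powr l_def flip: powr_real_of_int')
  show thesis
  proof
    have "ln (norm q) \<le> ln (norm (q powi n * x))"
      unfolding ln_eq using n by (simp add: l_def algebra_simps)
    then show "norm q \<le> norm (q powi n * x)"
      using assms norm_q_pos by simp
    have "ln (norm (q powi n * x)) \<le> ln 1"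
      unfolding ln_eq using n by simp
    then show "norm (q powi n * x) \<le> 1"
      using assms by (subst (asm) ln_le_cancel_iff) auto
  qed
qed

text \<open>The relation extends by continuity from the complement of the countable set of powers of \<open>q\<close> to the
  punctured plane. Hence \<open>\<bar>F\<bar>\<close> is determined by its values on a compact annulus and is bounded, and
  Liouville's theorem applies to the entire function \<open>F \<circ> exp\<close>.\<close>
lemma quasiperiodic_imp_constant:
  assumes hol: "F holomorphic_on - {0}" and c: "norm c = 1"
    and eq: "\<And>x. x \<noteq> 0 \<Longrightarrow> (\<And>n. x \<noteq> q powi n) \<Longrightarrow> F (q * x) = c * F x"
    and x: "x \<noteq> 0"
  shows "F x = F 1"
proof -
  have cont: "isCont F y" if "y \<noteq> 0" for y
    using holomorphic_on_imp_continuous_on[OF hol] that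
    by (simp add: continuous_on_eq_continuous_at open_Compl)
  have eq': "F (q * y) = c * F y" if "y \<noteq> 0" for y
  proof -
    define A where "A = insert 0 (range (\<lambda>n::int. q powi n))"
    have "countable A" by (simp add: A_def)
    then have "interior A = {}"
      by (meson countable_subset ex_in_conv mem_interior uncountable_ball)
    then have "y \<in> closure (- A)"
      by (simp add: closure_complement)
    then obtain s where s: "\<And>n. s n \<in> - A" "s \<longlonglongrightarrow> y"
      by (auto simp: closure_sequential)
    have "(\<lambda>n. F (q * s n)) \<longlonglongrightarrow> F (q * y)"
      using that s by (intro isCont_tendsto_compose[OF cont] tendsto_intros) auto
    moreover have "(\<lambda>n. c * F (s n)) \<longlonglongrightarrow> c * F y"
      using that s by (intro isCont_tendsto_compose[OF cont] tendsto_intros) auto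
    moreover have "F (q * s n) = c * F (s n)" for n
      using s(1)[of n] by (intro eq) (auto simp: A_def)
    ultimately show ?thesis
      using LIMSEQ_unique by simp
  qed
  have norm_step: "norm (F (q powi n * y)) = norm (F y)" if "y \<noteq> 0" for n y
  proof (induction n rule: int_induct[where k = 0])
    case (step1 i)
    have "F (q powi (i + 1) * y) = c * F (q powi i * y)"
      using eq'[of "q powi i * y"] that by (simp add: power_int_add mult_ac)
    then show ?case using step1 c by (simp add: norm_mult)
  next
    case (step2 i)
    have "F (q powi i * y) = c * F (q powi (i - 1) * y)"
      using eq'[of "q powi (i - 1) * y"] that by (simp add: power_int_diff mult_ac)
    then show ?case using step2 c by (simp add: norm_mult)
  qed simp
  define S where "S = cball 0 1 - ball (0 :: complex) (norm q)"
  have "compact S"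
    unfolding S_def by (intro compact_diff compact_cball open_ball)
  moreover have "continuous_on S F"
    using norm_q_pos by (intro continuous_at_imp_continuous_on ballI cont) (auto simp: S_def)
  ultimately have "bounded (F ` S)"
    by (intro compact_imp_bounded compact_continuous_image)
  then obtain B where B: "\<And>y. y \<in> S \<Longrightarrow> norm (F y) \<le> B"
    by (auto simp: bounded_iff)
  have "norm (F y) \<le> B" if y: "y \<noteq> 0" for y
  proof -
    obtain n where "norm q \<le> norm (q powi n * y)" "norm (q powi n * y) \<le> 1"
      using fundamental_annulus[OF y] by blast
    then have "norm (F (q powi n * y)) \<le> B"
      by (intro B) (simp add: S_def)
    then show ?thesis using norm_step[OF y] by simp
  qed
  then have "bounded (range (F \<circ> exp))"
    by (intro boundedI[where B = B]) auto
  moreover have "(F \<circ> exp) holomorphic_on UNIV"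
    by (rule holomorphic_on_compose_gen[OF _ hol]) (auto intro: holomorphic_intros)
  ultimately have "(F \<circ> exp) constant_on UNIV"
    by (rule_tac Liouville_theorem)
  then have "F (exp (Ln x)) = F (exp 0)"
    unfolding constant_on_def by (metis UNIV_I comp_apply)
  then show ?thesis using x by simp
qed

section \<open>Partial fractions of the reciprocal theta function\<close>

text \<open>Let \<open>L(x)\<close> be the sum. Then \<open>L(q x) + x L(x)\<close> is, up to sign, the series of \<open>\<Theta>(1; q) = 0\<close>. So \<open>\<Theta> L\<close> is
  invariant under \<open>x \<mapsto> q x\<close>, hence constant; at \<open>x = 1\<close> only the summand \<open>n = 0\<close> survives.\<close>
lemma infsum_reciprocal_Theta:
  assumes "x \<noteq> 0" "\<And>n. x \<noteq> q powi n"
  shows "(\<Sum>\<^sub>\<infinity>n. (- 1) powi n * q powi (tri n + n) / (1 - x * q powi n)) = qpoch q q ^ 3 / Theta x q"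
proof -
  define \<alpha> where "\<alpha> = (\<lambda>n. (- 1) powi n * q powi (tri n + n))"
  have rapid: "rapid \<alpha>"
    using rapid_mult_powi[OF rapid_theta, of q] by (simp add: \<alpha>_def power_int_add mult.assoc)
  have \<alpha>: "\<alpha> summable_on UNIV"
    using rapid_summable[OF rapid, of 1] by simp
  have "theta_sum \<alpha> x = theta_sum \<alpha> 1"
  proof (rule quasiperiodic_imp_constant[where c = 1])
    show "theta_sum \<alpha> holomorphic_on - {0}"
      by (rule holomorphic_theta_sum[OF \<alpha>])
    fix y :: complex assume y: "y \<noteq> 0" "\<And>n. y \<noteq> q powi n"
    have qy: "q * y \<noteq> q powi n" for n
      using y(2)[of "n - 1"] by (auto simp: power_int_diff field_simps)
    let ?b = "\<lambda>n. \<alpha> n / (1 - y * q powi n)"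
    have b: "?b summable_on UNIV"
      using rapid_summable[OF rapid_divide_one_minus[OF rapid y], of 1] by simp
    have "(\<Sum>\<^sub>\<infinity>n. \<alpha> n / (1 - q * y * q powi n)) =
        (\<Sum>\<^sub>\<infinity>n. \<alpha> (n + - 1) / (1 - q * y * q powi (n + - 1)))"
      by (rule infsum_reindex_bij_betw[symmetric]) (rule bij_plus_right)
    also have "\<dots> = (\<Sum>\<^sub>\<infinity>n. - y * ?b n + - 1 * ((- 1) powi n * q powi (tri n)))"
    proof (rule infsum_cong)
      fix n :: int
      have d: "1 - y * q powi n \<noteq> 0"
        using y(2)[of "- n"] by (auto simp: power_int_minus field_simps)
      have 1: "1 - q * y * q powi (n + - 1) = 1 - y * q powi n"
        by (simp add: power_int_diff)
      have "tri (n + - 1) + (n + - 1) = tri n"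
        by (simp only: tri_add tri_simps)
      then have 2: "\<alpha> (n + - 1) = - ((- 1) powi n * q powi (tri n))"
        by (auto simp: \<alpha>_def neg_one_powi_cases)
      have 3: "\<alpha> n = (- 1) powi n * q powi (tri n) * q powi n"
        by (simp add: \<alpha>_def power_int_add)
      show "\<alpha> (n + - 1) / (1 - q * y * q powi (n + - 1)) =
          - y * ?b n + - 1 * ((- 1) powi n * q powi (tri n))"
        unfolding 1 2 3 using d by (simp add: divide_simps) (simp add: algebra_simps)
    qed
    also have "\<dots> = - y * (\<Sum>\<^sub>\<infinity>n. ?b n) + - 1 * (\<Sum>\<^sub>\<infinity>n. (- 1) powi n * q powi (tri n))"
      using b rapid_summable[OF rapid_theta, of 1]
      by (subst infsum_add) (simp_all only: infsum_cmult_right' summable_on_cmult_right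
          power_int_1_left mult_1_right one_neq_zero not_False_eq_True)
    also have "(\<Sum>\<^sub>\<infinity>n. (- 1) powi n * q powi (tri n)) = 0"
      using infsum_theta_eq_0[of 0] by simp
    finally show "theta_sum \<alpha> (q * y) = 1 * theta_sum \<alpha> y"
      using y(1) by (simp add: theta_sum_eq[OF qy] theta_sum_eq[OF y(2)] Theta_q_mult)
  qed (use assms in auto)
  also have "\<dots> = qpoch q q ^ 3"
    by (simp add: theta_sum_1 \<alpha>_def)
  finally show ?thesis
    using Theta_nonzero[OF assms] by (simp add: theta_sum_eq[OF assms(2)] \<alpha>_def field_simps)
qed

text \<open>Lowering the linear exponent by one multiplies the sum by \<open>x\<close>: the two sides differ by a theta series
  at a power of \<open>q\<close>, which vanishes. The induction starts one step earlier, at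
  \<open>infsum_reciprocal_Theta\<close>, which is the case \<open>l = - 1\<close>.\<close>
lemma infsum_reciprocal_Theta_shifted:
  assumes "x \<noteq> 0" "\<And>n. x \<noteq> q powi n"
  shows "(\<Sum>\<^sub>\<infinity>n. (- 1) powi n * q powi (tri n - int l * n) / (1 - x * q powi n)) =
    x ^ Suc l * qpoch q q ^ 3 / Theta x q"
proof -
  have *: "(\<Sum>\<^sub>\<infinity>n. (- 1) powi n * q powi (tri n + (1 - int l) * n) / (1 - x * q powi n)) =
    x ^ l * qpoch q q ^ 3 / Theta x q" for l
  proof (induction l)
    case 0
    then show ?case using infsum_reciprocal_Theta[OF assms] by simp
  next
    case (Suc l)
    let ?c = "\<lambda>l n. (- 1) powi n * q powi (tri n + l * n)"
    have rapid: "rapid (?c l)" for l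
      using rapid_mult_powi[OF rapid_theta, of "q powi l"]
      by (simp add: power_int_add power_int_mult mult.assoc)
    have s: "(\<lambda>n. ?c l n / (1 - x * q powi n)) summable_on UNIV" for l
      using rapid_summable[OF rapid_divide_one_minus[OF rapid assms], of 1] by simp
    have s': "?c l summable_on UNIV" for l
      using rapid_summable[OF rapid, of 1] by simp
    have "?c (1 - int (Suc l)) n / (1 - x * q powi n) =
        ?c (1 - int (Suc l)) n + x * (?c (1 - int l) n / (1 - x * q powi n))" for n
    proof -
      have d: "1 - x * q powi n \<noteq> 0"
        using assms(2)[of "- n"] by (auto simp: power_int_minus field_simps)
      have "tri n + (1 - int l) * n = tri n + (1 - int (Suc l)) * n + n"
        by (simp add: algebra_simps)
      then have "?c (1 - int l) n = ?c (1 - int (Suc l)) n * q powi n"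
        by (simp only: power_int_add q_nonzero simp_thms mult.assoc)
      then show ?thesis using d by (simp add: divide_simps) (simp add: algebra_simps)
    qed
    then have "(\<Sum>\<^sub>\<infinity>n. ?c (1 - int (Suc l)) n / (1 - x * q powi n)) =
        (\<Sum>\<^sub>\<infinity>n. ?c (1 - int (Suc l)) n) + x * (\<Sum>\<^sub>\<infinity>n. ?c (1 - int l) n / (1 - x * q powi n))"
      using s s' by (simp only: infsum_add summable_on_cmult_right infsum_cmult_right')
    then show ?case
      using Suc infsum_theta_eq_0[of "1 - int (Suc l)"] by simp
  qed
  show ?thesis using *[of "Suc l"] by simp
qed

end

section \<open>The Hecke-type double sums as single sums\<close>

text \<open>Linear growth is absorbed into geometric growth, which the coefficients of a Laurent series on the
  punctured plane tolerate in both directions.\<close>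
lemma three_powi_bound: "2 * real_of_int \<bar>n\<bar> + 1 \<le> 3 powi n + 3 powi (- n)"
proof -
  have *: "2 * real k + 1 \<le> 3 ^ k" for k
    by (induction k) auto
  consider k where "n = int k" | k where "n = - int k" by (metis int_cases2)
  then show ?thesis
  proof cases
    case 1
    then show ?thesis using *[of k] by (simp add: add_increasing2)
  next
    case 2
    then show ?thesis using *[of k] by (simp add: add_increasing)
  qed
qed

locale hecke = nome +
  fixes t m :: int
  assumes t_ge: "2 \<le> t" and m_ge: "1 \<le> m" and m_less: "m < t"
begin

text \<open>For \<open>r = n + j\<close> and \<open>s = n - j\<close>, the signs of \<open>r\<close> and \<open>s\<close> agree exactly when \<open>\<bar>j\<bar>\<close> is at most \<open>radius n\<close>; the
  cut-off is asymmetric in \<open>n\<close> because \<open>sg 0 = 1\<close>.\<close>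
definition radius :: "int \<Rightarrow> int" where
  "radius n = (if 0 \<le> n then n else - n - 1)"

text \<open>The exponent of \<open>q\<close> in the double sum in terms of \<open>n\<close> and \<open>j\<close>; see \<open>qexpo_eq\<close>.\<close>
definition expo :: "int \<Rightarrow> int \<Rightarrow> int" where
  "expo n j = t * (n * (n + 1)) - (2 * t - 1) * tri j - m * j"

definition hcoeff :: "int \<Rightarrow> complex" where
  "hcoeff n = sg n * (\<Sum>j\<in>{- radius n..radius n}. (- 1) powi j * q powi expo n j)"

text \<open>A bound for \<open>hcoeff n\<close> that ignores cancellation, so that it also controls the double sum: there are at
  most \<open>2 \<bar>n\<bar> + 1\<close> summands, and \<open>expo_ge\<close> applies to each.\<close>
definition bound :: "int \<Rightarrow> real" where
  "bound n = (2 * real_of_int \<bar>n\<bar> + 1) * norm q powi (tri (n + 1))"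

text \<open>The quadratic form is indefinite, but on the cone \<open>\<bar>j\<bar> \<le> N = radius n\<close> it is bounded below: twice the
  difference of the two sides is \<open>(2 t - 1) (N + j) (N + 1 - j) - 2 m j\<close>. For \<open>j > 0\<close> this is nonnegative
  since \<open>N + j \<ge> 2 j\<close>, \<open>N + 1 - j \<ge> 1\<close> and \<open>m \<le> 2 t - 1\<close>. All convergence below rests on this bound.\<close>
lemma expo_ge:
  assumes "\<bar>j\<bar> \<le> radius n"
  shows "tri (n + 1) \<le> expo n j"
proof -
  define N where "N = radius n"
  have N: "n * (n + 1) = N * (N + 1)"
    by (simp add: N_def radius_def algebra_simps)
  have "2 * (m * j) \<le> (2 * t - 1) * ((N + j) * (N + 1 - j))"
  proof (cases "j \<le> 0")
    case True
    then have "m * j \<le> 0" using m_ge by (simp add: mult_nonneg_nonpos)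
    moreover have "0 \<le> (2 * t - 1) * ((N + j) * (N + 1 - j))"
      using assms t_ge by (intro mult_nonneg_nonneg) (auto simp: N_def)
    ultimately show ?thesis by linarith
  next
    case False
    have "m * (2 * j) \<le> (2 * t - 1) * (2 * j)"
      using False m_less t_ge by (intro mult_right_mono) auto
    also have "\<dots> \<le> (2 * t - 1) * ((N + j) * 1)"
      using assms t_ge by (intro mult_left_mono) (auto simp: N_def)
    also have "\<dots> \<le> (2 * t - 1) * ((N + j) * (N + 1 - j))"
      using assms t_ge by (intro mult_left_mono) (auto simp: N_def)
    finally show ?thesis by (simp add: algebra_simps)
  qed
  moreover have "2 * expo n j - 2 * tri (n + 1) = (2 * t - 1) * ((N + j) * (N + 1 - j)) - 2 * (m * j)"
  proof -
    have 1: "2 * tri (n + 1) = N * (N + 1)"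
      using two_tri[of "n + 1"] N by (simp add: mult.commute)
    have "2 * expo n j = 2 * t * (n * (n + 1)) - (2 * t - 1) * (2 * tri j) - 2 * (m * j)"
      by (simp add: expo_def algebra_simps)
    then have 2: "2 * expo n j = 2 * t * (N * (N + 1)) - (2 * t - 1) * (j * (j - 1)) - 2 * (m * j)"
      unfolding two_tri N .
    show ?thesis unfolding 1 2 by (simp add: algebra_simps)
  qed
  ultimately show ?thesis by linarith
qed

lemma sum_norm_le_bound:
  "(\<Sum>j\<in>{- radius n..radius n}. norm ((- 1) powi j * q powi expo n j)) \<le> bound n"
proof -
  have "(\<Sum>j\<in>{- radius n..radius n}. norm ((- 1) powi j * q powi expo n j))
      \<le> of_nat (card {- radius n..radius n}) * norm q powi (tri (n + 1))"
  proof (rule sum_bounded_above)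
    fix j assume "j \<in> {- radius n..radius n}"
    then have "tri (n + 1) \<le> expo n j" by (intro expo_ge) auto
    then show "norm ((- 1) powi j * q powi expo n j) \<le> norm q powi (tri (n + 1))"
      using norm_q_pos norm_q_less_1
      by (simp add: norm_mult norm_power_int power_int_decreasing)
  qed
  also have "\<dots> \<le> bound n"
    unfolding bound_def
  proof (rule mult_right_mono)
    show "of_nat (card {- radius n..radius n}) \<le> 2 * real_of_int \<bar>n\<bar> + 1"
      by (simp add: radius_def)
  qed simp
  finally show ?thesis .
qed

lemma norm_sg [simp]: "norm (sg n) = 1"
  by (simp add: sg_def)

lemma norm_hcoeff_le: "norm (hcoeff n) \<le> bound n"
  unfolding hcoeff_def norm_mult norm_sg mult_1
  by (rule order_trans[OF norm_sum sum_norm_le_bound])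

lemma bound_nonneg [simp]: "0 \<le> bound n"
  by (simp add: bound_def)

lemma rapid_bound: "rapid (\<lambda>n. of_real (bound n))"
proof -
  define c where "c = (\<lambda>n. (- 1) powi n * q powi (tri n + 1 * n))"
  have "rapid (\<lambda>n. c n * 3 powi n + c n * (inverse 3) powi n)"
    unfolding c_def by (intro rapid_add rapid_mult_powi rapid_theta_linear) auto
  then show ?thesis
  proof (rule rapid_bounded_mult[where C = 1])
    fix n
    have "norm (c n * 3 powi n + c n * (inverse 3) powi n) =
        norm (c n) * norm (of_real (3 powi n + 3 powi (- n)) :: complex)"
      by (simp add: norm_mult[symmetric] distrib_left power_int_minus power_int_one_over inverse_eq_divide)
    also have "\<dots> = norm q powi (tri (n + 1)) * (3 powi n + 3 powi (- n))"
      unfolding norm_of_real c_def using tri_add[of n 1] by (simp add: norm_mult norm_power_int)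
    finally show "norm (complex_of_real (bound n)) \<le> 1 * norm (c n * 3 powi n + c n * inverse 3 powi n)"
      using three_powi_bound[of n]
      by (simp only: norm_of_real abs_of_nonneg[OF bound_nonneg] bound_def mult_1 mult.commute)
         (simp add: mult_left_mono)
  qed
qed

lemma rapid_hcoeff: "rapid hcoeff"
  by (rule rapid_bounded_mult[OF rapid_bound, where C = 1]) (simp add: norm_hcoeff_le)

lemma qexpo_eq: "qexpo t (t + k) (m + k) (n + j) (n - j) = expo n j + k * n"
proof -
  have "8 * expo n j = 8 * (t * (n * (n + 1))) - 4 * (2 * t - 1) * (2 * tri j) - 8 * (m * j)"
    by (simp add: expo_def algebra_simps)
  then have "(n + j)\<^sup>2 + 2 * (4 * t - 1) * (n + j) * (n - j) + (n - j)\<^sup>2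
      + 2 * (4 * (t + k) - 1 - 2 * (m + k)) * (n + j) + 2 * (1 + 2 * (m + k)) * (n - j)
      = 8 * (expo n j + k * n)"
    unfolding two_tri by (simp add: algebra_simps power2_eq_square)
  then show ?thesis by (simp add: qexpo_def)
qed

lemma sg2_eq: "sg2 (n + j) (n - j) = (if \<bar>j\<bar> \<le> radius n then sg n else 0)"
  by (auto simp: sg2_def sg_def radius_def)

text \<open>The substitution \<open>(r, s) = (n + j, n - j)\<close> identifies the pairs of equal parity with all pairs \<open>(n, j)\<close>.
  The weight \<open>w\<close> is a power \<open>q^(k n)\<close> for the constants \<open>\<theta>\<close> and \<open>1 / (1 - x q^n)\<close> for \<open>g\<close>.\<close>
lemma infsum_same_parity:
  assumes "(\<lambda>n. of_real (bound n) * w n) summable_on UNIV"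
    and F: "\<And>n j. F (n + j, n - j) = sg2 (n + j) (n - j) * ((- 1) powi j * q powi expo n j) * w n"
  shows "infsum F same_parity = (\<Sum>\<^sub>\<infinity>n. hcoeff n * w n)"
proof -
  define h :: "int \<times> int \<Rightarrow> int \<times> int" where "h = (\<lambda>(n, j). (n + j, n - j))"
  define J where "J = (\<lambda>n. {- radius n..radius n})"
  define f where "f = (\<lambda>(n, j). sg n * ((- 1) powi j * q powi expo n j) * w n)"
  have "bij_betw h UNIV same_parity"
  proof (rule bij_betw_byWitness[where f' = "\<lambda>(r, s). ((r + s) div 2, (r - s) div 2)"])
    show "\<forall>a\<in>same_parity. h (case a of (r, s) \<Rightarrow> ((r + s) div 2, (r - s) div 2)) = a"
    proof
      fix a :: "int \<times> int" assume "a \<in> same_parity"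
      then obtain r s where a: "a = (r, s)" "r mod 2 = s mod 2" by (auto simp: same_parity_def)
      then have "even (r - s)" by (simp add: mod_eq_dvd_iff)
      then obtain k where "r = s + 2 * k" by (metis add.commute diff_add_cancel dvdE)
      then have "r + s = 2 * (s + k)" "r - s = 2 * k" "r = s + 2 * k" by simp_all
      then show "h (case a of (r, s) \<Rightarrow> ((r + s) div 2, (r - s) div 2)) = a"
        unfolding a h_def by simp
    qed
    show "h ` UNIV \<subseteq> same_parity"
      unfolding h_def same_parity_def by auto presburger
  qed (auto simp: h_def)
  then have "infsum F same_parity = (\<Sum>\<^sub>\<infinity>a. F (h a))"
    by (rule infsum_reindex_bij_betw[symmetric])
  also have "\<dots> = infsum f (Sigma UNIV J)"
    by (rule infsum_cong_neutral) (auto simp: h_def J_def f_def F sg2_eq split: if_splits)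
  also have "\<dots> = (\<Sum>\<^sub>\<infinity>n. \<Sum>\<^sub>\<infinity>j\<in>J n. f (n, j))"
  proof (rule infsum_Sigma_banach[symmetric], rule abs_summable_summable)
    have "(\<lambda>n. norm (of_real (bound n) * w n)) summable_on UNIV"
      using assms(1) by (simp add: summable_on_iff_abs_summable_on_complex)
    moreover have "(\<Sum>\<^sub>\<infinity>j\<in>J n. norm (f (n, j))) \<le> norm (of_real (bound n) * w n)" for n
    proof -
      have "(\<Sum>\<^sub>\<infinity>j\<in>J n. norm (f (n, j))) =
          (\<Sum>j\<in>J n. norm ((- 1) powi j * q powi expo n j)) * norm (w n)"
        by (simp add: J_def f_def norm_mult sum_distrib_right)
      also have "\<dots> \<le> bound n * norm (w n)"
        unfolding J_def by (intro mult_right_mono sum_norm_le_bound) auto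
      finally show ?thesis by (simp add: norm_mult)
    qed
    ultimately have "(\<lambda>n. \<Sum>\<^sub>\<infinity>j\<in>J n. norm (f (n, j))) summable_on UNIV"
      by (rule summable_on_comparison_test) (auto intro: infsum_nonneg)
    then have "(\<lambda>n. norm (\<Sum>\<^sub>\<infinity>j\<in>J n. norm (f (n, j)))) summable_on UNIV"
      by (simp add: infsum_nonneg)
    then show "(\<lambda>x. norm (f x)) summable_on Sigma UNIV J"
      unfolding Infinite_Sum.abs_summable_on_Sigma_iff by (simp add: J_def)
  qed
  also have "\<dots> = (\<Sum>\<^sub>\<infinity>n. hcoeff n * w n)"
    by (simp add: J_def f_def hcoeff_def sum_distrib_left sum_distrib_right)
  finally show ?thesis .
qed

lemma theta_coeff_eq: "theta_coeff q t (t + k) (m + k) = (\<Sum>\<^sub>\<infinity>n. hcoeff n * (q powi k) powi n)"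
  unfolding theta_coeff_def
proof (rule infsum_same_parity)
  show "(\<lambda>n. of_real (bound n) * (q powi k) powi n) summable_on UNIV"
    by (rule rapid_summable[OF rapid_bound]) simp
qed (simp add: qexpo_eq power_int_add power_int_mult)

lemma g_fun_eq:
  assumes "x \<noteq> 0" "\<And>n. x \<noteq> q powi n"
  shows "g_fun q t m x = (\<Sum>\<^sub>\<infinity>n. hcoeff n / (1 - x * q powi n))"
proof -
  have "g_fun q t m x = (\<Sum>\<^sub>\<infinity>n. hcoeff n * (1 / (1 - x * q powi n)))"
    unfolding g_fun_def
  proof (rule infsum_same_parity)
    show "(\<lambda>n. of_real (bound n) * (1 / (1 - x * q powi n))) summable_on UNIV"
      using rapid_summable[OF rapid_divide_one_minus[OF rapid_bound assms], of 1] by simp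
  qed (use qexpo_eq[of 0] in simp)
  then show ?thesis by simp
qed

lemma f_fun_eq:
  assumes "x \<noteq> 0" "\<And>n. x \<noteq> q powi n"
  shows "f_fun q t m x = theta_sum hcoeff x / qpoch q q ^ 3"
  using assms by (simp add: f_fun_def g_fun_eq theta_sum_eq)

section \<open>The functional equation of the double sum\<close>

text \<open>The factor \<open>q^(2 t n)\<close> makes the exponents in \<open>hcoeff (n - 1)\<close> agree with those in \<open>hcoeff n\<close>, so the
  difference consists of the end terms \<open>j = n\<close> and \<open>j = - n\<close> alone. For \<open>n = 0\<close> both end terms are the
  summand \<open>j = 0\<close>, which is counted twice because \<open>sg 0 = 1\<close> and \<open>sg (- 1) = - 1\<close>.\<close>
lemma hcoeff_rec:
  "hcoeff n - q powi (2 * t * n) * hcoeff (n - 1) =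
     (- 1) powi n * (q powi (tri n + (2 * t - m) * n) + q powi (tri n + (m + 1) * n))"
proof -
  define e where "e = (\<lambda>j. (- 1) powi j * q powi expo n j)"
  have "expo n j = 2 * t * n + expo (n - 1) j" for j
    by (simp add: expo_def algebra_simps)
  then have "q powi (2 * t * n) * hcoeff (n - 1) = sg (n - 1) * sum e {- radius (n - 1)..radius (n - 1)}"
    by (simp add: hcoeff_def e_def power_int_add sum_distrib_left mult_ac)
  moreover have "hcoeff n = sg n * sum e {- radius n..radius n}"
    by (simp add: hcoeff_def e_def)
  moreover have "sg n * sum e {- radius n..radius n} -
      sg (n - 1) * sum e {- radius (n - 1)..radius (n - 1)} = e n + e (- n)"
  proof -
    \<comment> \<open>Enlarging the radius from \<open>N - 1\<close> to \<open>N\<close> adds the two distinct terms \<open>N\<close> and \<open>- N\<close>.\<close>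
    have ends: "sum e {- N..N} = sum e {- (N - 1)..N - 1} + (e N + e (- N))" if "N \<ge> 1" for N
    proof -
      have "{- N..N} = insert N (insert (- N) {- (N - 1)..N - 1})"
        using that by auto
      moreover have "N \<notin> insert (- N) {- (N - 1)..N - 1}" "- N \<notin> {- (N - 1)..N - 1}"
        using that by auto
      ultimately show ?thesis by simp
    qed
    consider "n \<ge> 1" | "n = 0" | "n \<le> -1" by linarith
    then show ?thesis
    proof cases
      case 1
      then show ?thesis using ends[of n] by (simp add: radius_def sg_def)
    next
      case 2
      then show ?thesis by (simp add: radius_def sg_def)
    next
      case 3
      then have "radius n = - n - 1" "radius (n - 1) = - n" "sg n = -1" "sg (n - 1) = -1"
        by (auto simp: radius_def sg_def)
      then show ?thesis using ends[of "- n"] 3 by simp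
    qed
  qed
  moreover have "e n = (- 1) powi n * q powi (tri n + (2 * t - m) * n)"
  proof -
    have "2 * expo n n = 2 * (t * (n * (n + 1))) - (2 * t - 1) * (2 * tri n) - 2 * (m * n)"
      by (simp add: expo_def algebra_simps)
    also have "\<dots> = 2 * tri n + 2 * ((2 * t - m) * n)"
      unfolding two_tri by (simp add: algebra_simps)
    finally have "expo n n = tri n + (2 * t - m) * n" by linarith
    then show ?thesis by (simp add: e_def)
  qed
  moreover have "e (- n) = (- 1) powi n * q powi (tri n + (m + 1) * n)"
  proof -
    have "2 * expo n (- n) = 2 * (t * (n * (n + 1))) - (2 * t - 1) * (2 * tri n + 2 * n) + 2 * (m * n)"
      by (simp add: expo_def tri_minus algebra_simps)
    also have "\<dots> = 2 * tri n + 2 * ((m + 1) * n)"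
      unfolding two_tri by (simp add: algebra_simps)
    finally have "expo n (- n) = tri n + (m + 1) * n" by linarith
    then show ?thesis by (simp add: e_def neg_one_powi_cases)
  qed
  ultimately show ?thesis by (simp add: distrib_left)
qed

text \<open>With \<open>q^(-2 t n)\<close> absorbed, \<open>scaled n\<close> and \<open>hcoeff (n - 1)\<close> differ by two theta-type terms.\<close>
abbreviation scaled :: "int \<Rightarrow> complex" where
  "scaled n \<equiv> hcoeff n * q powi (- 2 * t * n)"

lemma hcoeff_pred:
  "hcoeff (n - 1) = scaled n - (- 1) powi n * q powi (tri n + (- m) * n)
      - (- 1) powi n * q powi (tri n + (m + 1 - 2 * t) * n)"
proof -
  have "hcoeff (n - 1) = q powi (- 2 * t * n) * (q powi (2 * t * n) * hcoeff (n - 1))"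
    by (simp add: power_int_minus)
  also have "\<dots> = scaled n - (- 1) powi n * (q powi (- 2 * t * n) * q powi (tri n + (2 * t - m) * n)
       + q powi (- 2 * t * n) * q powi (tri n + (m + 1) * n))"
    using hcoeff_rec[of n] by (simp add: algebra_simps)
  also have "q powi (- 2 * t * n) * q powi (tri n + (2 * t - m) * n) = q powi (tri n + (- m) * n)"
    by (simp add: algebra_simps flip: power_int_add)
  also have "q powi (- 2 * t * n) * q powi (tri n + (m + 1) * n) = q powi (tri n + (m + 1 - 2 * t) * n)"
    by (simp add: algebra_simps flip: power_int_add)
  finally show ?thesis by (simp add: algebra_simps)
qed

lemma rapid_scaled: "rapid scaled"
  using rapid_mult_powi[OF rapid_hcoeff, of "q powi (- 2 * t)"] by (simp flip: power_int_mult)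

text \<open>Replacing \<open>scaled n\<close> by \<open>hcoeff (n - 1)\<close> costs two theta series at powers of \<open>q\<close>, both zero; the shift of
  \<open>n\<close> accounts for the factor \<open>q^k\<close>.\<close>
lemma infsum_scaled:
  "(\<Sum>\<^sub>\<infinity>n. scaled n * (q powi k) powi n) = q powi k * theta_coeff q t (t + k) (m + k)"
proof -
  let ?u = "\<lambda>l n. (- 1) powi n * q powi (tri n + l * n)"
  have u: "?u l summable_on UNIV" for l
    using rapid_summable[OF rapid_theta_linear, of 1] by simp
  have c: "(\<lambda>n. hcoeff n * (q powi k) powi n) summable_on UNIV"
    by (rule rapid_summable[OF rapid_hcoeff]) simp
  have bij: "bij_betw (\<lambda>n. n + - 1) UNIV (UNIV :: int set)"
    by (rule bij_plus_right)
  have s: "(\<lambda>n. hcoeff (n + - 1) * (q powi k) powi (n + - 1)) summable_on UNIV"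
    using c summable_on_reindex_bij_betw[OF bij, of "\<lambda>n. hcoeff n * (q powi k) powi n"] by blast
  have "scaled n * (q powi k) powi n =
      q powi k * (hcoeff (n + - 1) * (q powi k) powi (n + - 1)) + ?u (k - m) n + ?u (k + m + 1 - 2 * t) n" for n
  proof -
    have 1: "(q powi k) powi n = q powi k * (q powi k) powi (n + - 1)"
      by (simp add: power_int_diff)
    have 2: "?u (k - m) n = ?u (- m) n * (q powi k) powi n"
      "?u (k + m + 1 - 2 * t) n = ?u (m + 1 - 2 * t) n * (q powi k) powi n"
      by (simp_all add: power_int_mult[symmetric] mult.assoc algebra_simps flip: power_int_add)
    have "scaled n = hcoeff (n + - 1) + ?u (- m) n + ?u (m + 1 - 2 * t) n"
      using hcoeff_pred[of n] by simp
    then show ?thesis unfolding 2 by (simp add: 1 distrib_left distrib_right)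
  qed
  then have "(\<Sum>\<^sub>\<infinity>n. scaled n * (q powi k) powi n) =
      q powi k * (\<Sum>\<^sub>\<infinity>n. hcoeff (n + - 1) * (q powi k) powi (n + - 1)) +
      (\<Sum>\<^sub>\<infinity>n. ?u (k - m) n) + (\<Sum>\<^sub>\<infinity>n. ?u (k + m + 1 - 2 * t) n)"
    using s u by (simp only: infsum_add summable_on_add summable_on_cmult_right infsum_cmult_right')
  also have "(\<Sum>\<^sub>\<infinity>n. hcoeff (n + - 1) * (q powi k) powi (n + - 1)) = theta_coeff q t (t + k) (m + k)"
    unfolding theta_coeff_eq by (rule infsum_reindex_bij_betw[OF bij])
  finally show ?thesis by (simp only: infsum_theta_eq_0 add_0_right)
qed

lemma geometric_sum_powi:
  fixes y :: complex
  assumes "0 \<le> N"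
  shows "(1 - y) * (\<Sum>k = 0..N - 1. y powi k) = 1 - y powi N"
  using assms
proof (induction N rule: int_ge_induct)
  case (step i)
  have "{0..i + 1 - 1} = insert i {0..i - 1}" using step by auto
  then have "(1 - y) * (\<Sum>k = 0..i + 1 - 1. y powi k) = (1 - y) * y powi i + (1 - y powi i)"
    using step by (simp add: distrib_left)
  also have "\<dots> = 1 - y powi (i + 1)"
    using step by (simp add: power_int_add_1' left_diff_distrib)
  finally show ?case .
qed simp

text \<open>In \<open>x^(2 t) g(x)\<close> the factor \<open>(x q^n)^(2 t)\<close> equals \<open>1\<close> minus \<open>1 - x q^n\<close> times a geometric sum, which
  splits off the moments. In \<open>g(q x)\<close> the index shift brings in \<open>hcoeff (n - 1)\<close> and with it two
  sums of the kind evaluated in \<open>infsum_reciprocal_Theta_shifted\<close>. The remaining sum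
  \<open>\<Sum> scaled n / (1 - x q^n)\<close> is common to both and cancels.\<close>
lemma theta_sum_functional_equation:
  assumes "x \<noteq> 0" "\<And>n. x \<noteq> q powi n"
  shows "x powi (2 * t) * theta_sum hcoeff x + x * theta_sum hcoeff (q * x) =
    qpoch q q ^ 3 * (x powi (m + 1) + x powi (2 * t - m)) -
    Theta x q * (\<Sum>k = 0..2 * t - 1. x powi k * q powi k * theta_coeff q t (t + k) (m + k))"
proof -
  let ?d = "\<lambda>n. 1 - x * q powi n"
  let ?u = "\<lambda>l n. (- 1) powi n * q powi (tri n + l * n)"
  let ?S = "\<Sum>k = 0..2 * t - 1. x powi k * q powi k * theta_coeff q t (t + k) (m + k)"
  have d: "?d n \<noteq> 0" for n
    using assms(2)[of "- n"] by (auto simp: power_int_minus field_simps)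
  have qx: "q * x \<noteq> q powi n" for n
    using assms(2)[of "n - 1"] by (auto simp: power_int_diff field_simps)
  have u: "(\<lambda>n. ?u l n / ?d n) summable_on UNIV" for l
    using rapid_summable[OF rapid_divide_one_minus[OF rapid_theta_linear assms], of 1] by simp
  have s: "(\<lambda>n. scaled n / ?d n) summable_on UNIV"
    using rapid_summable[OF rapid_divide_one_minus[OF rapid_scaled assms], of 1] by simp
  have bij: "bij_betw (\<lambda>n. n + - 1) UNIV (UNIV :: int set)"
    by (rule bij_plus_right)
  have gx: "x powi (2 * t) * (\<Sum>\<^sub>\<infinity>n. hcoeff n / ?d n) = (\<Sum>\<^sub>\<infinity>n. scaled n / ?d n) - ?S"
  proof -
    have "x powi (2 * t) * (hcoeff n / ?d n) =
        scaled n / ?d n + - 1 * (\<Sum>k = 0..2 * t - 1. x powi k * (scaled n * (q powi k) powi n))" for n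
    proof -
      have "(\<Sum>k = 0..2 * t - 1. x powi k * (scaled n * (q powi k) powi n)) =
          scaled n * (\<Sum>k = 0..2 * t - 1. (x * q powi n) powi k)"
        by (simp add: sum_distrib_left power_int_mult_distrib mult_ac flip: power_int_mult)
      also have "(\<Sum>k = 0..2 * t - 1. (x * q powi n) powi k) = (1 - (x * q powi n) powi (2 * t)) / ?d n"
        using geometric_sum_powi[of "2 * t" "x * q powi n"] t_ge d[of n] by (simp add: field_simps)
      also have "scaled n * ((1 - (x * q powi n) powi (2 * t)) / ?d n) =
          scaled n / ?d n - scaled n * (x * q powi n) powi (2 * t) / ?d n"
        by (simp add: diff_divide_distrib right_diff_distrib)
      also have "scaled n * (x * q powi n) powi (2 * t) = x powi (2 * t) * hcoeff n"
        by (simp add: power_int_mult_distrib power_int_mult[symmetric] power_int_minus mult_ac)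
      finally show ?thesis by simp
    qed
    moreover have k: "(\<lambda>n. x powi k * (scaled n * (q powi k) powi n)) summable_on UNIV" for k
      by (intro summable_on_cmult_right rapid_summable[OF rapid_scaled]) simp
    ultimately have "x powi (2 * t) * (\<Sum>\<^sub>\<infinity>n. hcoeff n / ?d n) = (\<Sum>\<^sub>\<infinity>n. scaled n / ?d n) +
       - 1 * (\<Sum>\<^sub>\<infinity>n. \<Sum>k = 0..2 * t - 1. x powi k * (scaled n * (q powi k) powi n))"
      using s by (simp only: infsum_cmult_right'[symmetric] infsum_add summable_on_cmult_right
          summable_on_finite_sum finite_atLeastAtMost_int)
    also have "(\<Sum>\<^sub>\<infinity>n. \<Sum>k = 0..2 * t - 1. x powi k * (scaled n * (q powi k) powi n)) = ?S"
      using k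
      by (simp only: infsum_finite_sum finite_atLeastAtMost_int infsum_cmult_right' infsum_scaled)
         (simp only: mult.assoc)
    finally show ?thesis by simp
  qed
  have gqx: "(\<Sum>\<^sub>\<infinity>n. hcoeff n / (1 - q * x * q powi n)) = (\<Sum>\<^sub>\<infinity>n. scaled n / ?d n)
      - qpoch q q ^ 3 / Theta x q * (x powi (m + 1) + x powi (2 * t - m))"
  proof -
    have "(\<Sum>\<^sub>\<infinity>n. hcoeff n / (1 - q * x * q powi n)) =
        (\<Sum>\<^sub>\<infinity>n. hcoeff (n + - 1) / (1 - q * x * q powi (n + - 1)))"
      by (rule infsum_reindex_bij_betw[OF bij, symmetric])
    also have "\<dots> = (\<Sum>\<^sub>\<infinity>n. scaled n / ?d n + - 1 * (?u (- m) n / ?d n) + - 1 * (?u (m + 1 - 2 * t) n / ?d n))"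
    proof (rule infsum_cong)
      fix n
      have 1: "1 - q * x * q powi (n + - 1) = ?d n" by (simp add: power_int_diff)
      show "hcoeff (n + - 1) / (1 - q * x * q powi (n + - 1)) =
         scaled n / ?d n + - 1 * (?u (- m) n / ?d n) + - 1 * (?u (m + 1 - 2 * t) n / ?d n)"
        unfolding 1 using hcoeff_pred[of n] by (simp add: diff_divide_distrib)
    qed
    also have "\<dots> = (\<Sum>\<^sub>\<infinity>n. scaled n / ?d n) + - 1 * (\<Sum>\<^sub>\<infinity>n. ?u (- m) n / ?d n)
         + - 1 * (\<Sum>\<^sub>\<infinity>n. ?u (m + 1 - 2 * t) n / ?d n)"
      using s u by (simp only: infsum_cmult_right' infsum_add summable_on_cmult_right summable_on_add)
    also have "(\<Sum>\<^sub>\<infinity>n. ?u (- m) n / ?d n) = qpoch q q ^ 3 / Theta x q * x powi (m + 1)"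
    proof -
      have "x ^ Suc (nat m) = x powi (m + 1)"
        using m_ge by (simp add: power_int_def nat_add_distrib)
      then show ?thesis
        using infsum_reciprocal_Theta_shifted[OF assms, of "nat m"] m_ge by simp
    qed
    also have "(\<Sum>\<^sub>\<infinity>n. ?u (m + 1 - 2 * t) n / ?d n) = qpoch q q ^ 3 / Theta x q * x powi (2 * t - m)"
    proof -
      have "x ^ Suc (nat (2 * t - 1 - m)) = x powi int (Suc (nat (2 * t - 1 - m)))"
        by (simp only: power_int_of_nat)
      also have "int (Suc (nat (2 * t - 1 - m))) = 2 * t - m"
        using m_less t_ge by simp
      finally have 1: "x ^ Suc (nat (2 * t - 1 - m)) = x powi (2 * t - m)" .
      have 2: "tri n + (m + 1 - 2 * t) * n = tri n - int (nat (2 * t - 1 - m)) * n" for n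
        using m_less t_ge by (simp add: algebra_simps)
      show ?thesis
        unfolding 2 infsum_reciprocal_Theta_shifted[OF assms] 1 by simp
    qed
    finally show ?thesis by (simp add: distrib_left)
  qed
  have \<Theta>: "Theta x q \<noteq> 0" by (rule Theta_nonzero[OF assms])
  have "Theta x q * (B - S) + x * (- Theta x q / x * (B - K / Theta x q * Y)) = K * Y - Theta x q * S"
    for B S K Y
    using \<Theta> assms(1) by (simp add: field_simps)
  then show ?thesis
    unfolding theta_sum_eq[OF assms(2)] theta_sum_eq[OF qx] gqx Theta_q_mult[OF assms(1)]
      mult.left_commute[of "x powi (2 * t)"] gx .
qed

end

section \<open>Solving W(x) + W(q x) = B(x) by Laurent series\<close>

context nome
begin

lemma nome_powi: "0 < d \<Longrightarrow> nome (q powi d)"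
  using norm_q_pos norm_q_less_1 power_int_strict_decreasing[of 0 d "norm q"]
  by unfold_locales (auto simp: norm_power_int)

text \<open>The termwise solution of \<open>W(x) + W(q x) = \<Sum> c(n) x^(d n + e)\<close>. Sums of this shape are the numerators of
  Appell functions.\<close>
definition halved :: "int \<Rightarrow> int \<Rightarrow> (int \<Rightarrow> complex) \<Rightarrow> complex \<Rightarrow> complex" where
  "halved d e c x = (\<Sum>\<^sub>\<infinity>n. c n * x powi (d * n + e) / (1 + q powi (d * n + e)))"

text \<open>If \<open>n \<noteq> 0\<close>, then \<open>\<bar>q^n\<bar>\<close> is at most \<open>\<bar>q\<bar>\<close> or at least \<open>1 / \<bar>q\<bar> \<ge> 2 - \<bar>q\<bar>\<close>; if \<open>n = 0\<close>, the value is \<open>2\<close>. So the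
  division in \<open>halved\<close> never blows up.\<close>
lemma norm_one_plus_powi: "1 - norm q \<le> norm (1 + q powi n)"
proof -
  consider "n \<ge> 1" | "n = 0" | "n \<le> -1" by linarith
  then show ?thesis
  proof cases
    case 1
    then have "norm (q powi n) \<le> norm q"
      using power_int_decreasing[of 1 n "norm q"] norm_q_pos norm_q_less_1
      by (simp add: norm_power_int)
    then show ?thesis using norm_diff_ineq[of 1 "q powi n"] by simp
  next
    case 2
    then have "norm (1 + q powi n) = 2" by simp
    then show ?thesis using norm_q_pos by linarith
  next
    case 3
    then have "norm q powi (- 1) \<le> norm (q powi n)"
      using power_int_decreasing[of n "- 1" "norm q"] norm_q_pos norm_q_less_1
      by (simp add: norm_power_int)
    moreover have "2 - norm q \<le> norm q powi (- 1)"
    proof -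
      have "0 \<le> (1 - norm q)\<^sup>2" by simp
      then have "(2 - norm q) * norm q \<le> 1"
        by (simp add: power2_eq_square algebra_simps)
      then show ?thesis
        using norm_q_pos by (simp add: power_int_minus field_simps)
    qed
    ultimately show ?thesis using norm_diff_ineq[of "q powi n" 1] by (simp add: add.commute)
  qed
qed

lemma one_plus_powi_nonzero: "1 + q powi n \<noteq> 0"
  using norm_one_plus_powi[of n] norm_q_less_1 by auto

lemma rapid_halved:
  assumes "rapid c"
  shows "rapid (\<lambda>n. c n / (1 + q powi (d * n + e)))"
proof (rule rapid_bounded_mult[OF assms])
  fix n
  have "norm (c n) / norm (1 + q powi (d * n + e)) \<le> norm (c n) / (1 - norm q)"
    using norm_one_plus_powi[of "d * n + e"] norm_q_less_1
    by (intro divide_left_mono mult_pos_pos) (auto simp: one_plus_powi_nonzero)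
  then show "norm (c n / (1 + q powi (d * n + e))) \<le> 1 / (1 - norm q) * norm (c n)"
    by (simp add: norm_divide)
qed

lemma halved_laurent:
  assumes "x \<noteq> 0"
  shows "halved d e c x = x powi e * (\<Sum>\<^sub>\<infinity>n. c n / (1 + q powi (d * n + e)) * (x powi d) powi n)"
proof -
  have "x powi (d * n + e) = x powi e * (x powi d) powi n" for n
    using assms by (simp add: power_int_add power_int_mult)
  then show ?thesis
    unfolding halved_def infsum_cmult_right'[symmetric] by (simp add: mult_ac)
qed

lemma holomorphic_halved:
  assumes "rapid c" shows "halved d e c holomorphic_on - {0}"
proof -
  let ?L = "\<lambda>y. \<Sum>\<^sub>\<infinity>n. c n / (1 + q powi (d * n + e)) * y powi n"
  have "(?L \<circ> (\<lambda>x. x powi d)) holomorphic_on - {0}"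
    by (rule holomorphic_on_compose_gen[OF _ holomorphic_on_laurent[OF rapid_halved[OF assms]]])
       (auto intro!: holomorphic_intros)
  moreover have "(\<lambda>x. x powi e) holomorphic_on - {0 :: complex}"
    by (intro holomorphic_intros) auto
  ultimately have "(\<lambda>x. x powi e * (?L \<circ> (\<lambda>x. x powi d)) x) holomorphic_on - {0}"
    by (rule_tac holomorphic_on_mult)
  then show ?thesis
    by (rule holomorphic_transform) (simp add: halved_laurent)
qed

lemma halved_add_shift:
  assumes "rapid c" "x \<noteq> 0"
  shows "halved d e c x + halved d e c (q * x) = x powi e * (\<Sum>\<^sub>\<infinity>n. c n * (x powi d) powi n)"
proof -
  let ?D = "\<lambda>n. 1 + q powi (d * n + e)"
  have s: "(\<lambda>n. c n / ?D n * (y powi d) powi n) summable_on UNIV" if "y \<noteq> 0" for y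
    by (rule rapid_summable[OF rapid_halved[OF assms(1)]]) (use that in simp)
  have "(\<lambda>n. x powi e * (c n / ?D n * (x powi d) powi n)) summable_on UNIV"
    "(\<lambda>n. (q * x) powi e * (c n / ?D n * ((q * x) powi d) powi n)) summable_on UNIV"
    using assms(2) by - (intro summable_on_cmult_right s; simp)+
  then have "halved d e c x + halved d e c (q * x) =
     (\<Sum>\<^sub>\<infinity>n. x powi e * (c n / ?D n * (x powi d) powi n) +
          (q * x) powi e * (c n / ?D n * ((q * x) powi d) powi n))"
    using assms(2)
    by (simp only: halved_laurent infsum_add infsum_cmult_right' mult_eq_0_iff q_nonzero simp_thms)
  also have "\<dots> = (\<Sum>\<^sub>\<infinity>n. x powi e * (c n * (x powi d) powi n))"
  proof (rule infsum_cong)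
    fix n
    have "(q * x) powi e * ((q * x) powi d) powi n = q powi (d * n + e) * (x powi e * (x powi d) powi n)"
      by (simp add: power_int_mult_distrib power_int_add power_int_mult mult_ac)
    then have 1: "x powi e * (x powi d) powi n + (q * x) powi e * ((q * x) powi d) powi n =
        x powi e * (x powi d) powi n * ?D n"
      by (simp add: ring_distribs mult_ac)
    have "x powi e * (c n / ?D n * (x powi d) powi n) +
          (q * x) powi e * (c n / ?D n * ((q * x) powi d) powi n) =
        c n / ?D n * (x powi e * (x powi d) powi n + (q * x) powi e * ((q * x) powi d) powi n)"
      by (simp only: distrib_left mult.left_commute)
    also have "\<dots> = x powi e * (c n * (x powi d) powi n)"
      unfolding 1 using one_plus_powi_nonzero[of "d * n + e"] by simp
    finally show "x powi e * (c n / ?D n * (x powi d) powi n) +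
          (q * x) powi e * (c n / ?D n * ((q * x) powi d) powi n) = x powi e * (c n * (x powi d) powi n)" .
  qed
  finally show ?thesis by (simp only: infsum_cmult_right')
qed

end

section \<open>The product of the two theta functions\<close>

context hecke
begin

abbreviation c :: int where "c \<equiv> 2 * t - 1"
abbreviation Q :: complex where "Q \<equiv> q powi c"
abbreviation G :: "complex \<Rightarrow> complex" where "G x \<equiv> Theta (- (x powi c)) Q"

sublocale Q: nome Q
  using t_ge by (intro nome_powi) simp

lemma G_series:
  assumes "x \<noteq> 0"
  shows "G x = (\<Sum>\<^sub>\<infinity>n. Q powi tri n * (x powi c) powi n)"
  using Q.Jacobi_triple_product[of "- (x powi c)"] assms by (simp add: neg_one_powi_mult_uminus)

lemma G_q_mult: "x \<noteq> 0 \<Longrightarrow> G (q * x) = G x / x powi c"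
  using Q.Theta_q_mult[of "- (x powi c)"] by (simp add: power_int_mult_distrib)

lemma holomorphic_G: "G holomorphic_on - {0}"
proof -
  have "((\<lambda>y. Theta y Q) \<circ> (\<lambda>x. - (x powi c))) holomorphic_on - {0}"
    by (rule holomorphic_on_compose_gen[OF _ Q.holomorphic_Theta]) (auto intro!: holomorphic_intros)
  then show ?thesis by (simp add: o_def)
qed

text \<open>The coefficient of \<open>x^s\<close> in the Laurent expansion of \<open>\<Theta>(x; q) G(x)\<close>.\<close>
definition mixed :: "int \<Rightarrow> complex" where
  "mixed s = (- 1) powi s * q powi tri s * Theta (q powi (c * (t - s))) (q powi (2 * t * c))"

text \<open>Increasing \<open>s\<close> by \<open>2 t r\<close> multiplies the argument of the theta function by the \<open>(-r)\<close>-th power of its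
  nome, so quasi-periodicity applies.\<close>
lemma mixed_shift:
  "mixed (s + 2 * t * r) = mixed s * ((- 1) powi r * (q powi (2 * t)) powi tri r * (q powi s) powi r)"
proof -
  interpret R: nome "q powi (2 * t * c)"
    using t_ge by (intro nome_powi) simp
  let ?R = "q powi (2 * t * c)"
  have 1: "q powi (c * (t - (s + 2 * t * r))) = ?R powi (- r) * q powi (c * (t - s))"
    by (simp add: power_int_add[symmetric] power_int_mult[symmetric] algebra_simps)
  have "Theta (q powi (c * (t - (s + 2 * t * r)))) ?R =
      (- 1) powi r * q powi (c * (t - s) * r - 2 * t * c * tri (- r)) * Theta (q powi (c * (t - s))) ?R"
    unfolding 1 by (subst R.Theta_shift) (simp_all add: neg_one_powi_cases
        power_int_mult[symmetric] flip: power_int_add)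
  moreover have "tri (s + 2 * t * r) + (c * (t - s) * r - 2 * t * c * tri (- r)) = tri s + (2 * t * tri r + s * r)"
  proof -
    have "2 * (tri (s + 2 * t * r) + (c * (t - s) * r - 2 * t * c * tri (- r))) =
       2 * tri (s + 2 * t * r) + 2 * (c * (t - s) * r) - 2 * t * c * (2 * tri (- r))"
      by (simp add: algebra_simps)
    also have "\<dots> = 2 * tri s + 2 * t * (2 * tri r) + 2 * (s * r)"
      unfolding two_tri by (simp add: algebra_simps)
    also have "\<dots> = 2 * (tri s + (2 * t * tri r + s * r))"
      by (simp add: algebra_simps)
    finally show ?thesis by (simp only: mult_cancel_left) simp
  qed
  then have "q powi tri (s + 2 * t * r) * q powi (c * (t - s) * r - 2 * t * c * tri (- r)) =
      q powi tri s * ((q powi (2 * t)) powi tri r * (q powi s) powi r)"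
    by (simp flip: power_int_add power_int_mult)
  moreover have "(- 1 :: complex) powi (s + 2 * t * r) = (- 1) powi s"
    by (simp add: neg_one_powi_cases)
  ultimately show ?thesis
    unfolding mixed_def by (simp add: mult_ac)
qed

text \<open>Multiply the two theta series and collect the terms with \<open>a + (2 t - 1) b = N\<close>. The inner sum over \<open>b\<close>
  is a theta series of nome \<open>q^(2 t (2 t - 1))\<close> and gives \<open>mixed N\<close>. Writing \<open>N = s + 2 t r\<close> with
  \<open>0 \<le> s < 2 t\<close>, the sum over \<open>r\<close> is by \<open>mixed_shift\<close> a theta series of nome \<open>q^(2 t)\<close>.\<close>
lemma Theta_mult_G:
  assumes "x \<noteq> 0"
  shows "Theta x q * G x =
    (\<Sum>s = 0..2 * t - 1. mixed s * x powi s * Theta (q powi s * x powi (2 * t)) (q powi (2 * t)))"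
proof -
  define u where "u = (\<lambda>n. (- 1) powi n * q powi tri n * x powi n)"
  define v where "v = (\<lambda>n. Q powi tri n * (x powi c) powi n)"
  define f where "f = (\<lambda>(a, b). u a * v b)"
  \<comment> \<open>The new first index \<open>N = a + c b\<close> is the exponent of \<open>x\<close>.\<close>
  define h :: "int \<times> int \<Rightarrow> int \<times> int" where "h = (\<lambda>(N, b). (N - c * b, b))"
  interpret R: nome "q powi (2 * t * c)"
    using t_ge by (intro nome_powi) simp
  interpret P: nome "q powi (2 * t)"
    using t_ge by (intro nome_powi) simp
  have u: "u summable_on UNIV"
    unfolding u_def by (rule rapid_summable[OF rapid_theta assms])
  have v: "v summable_on UNIV"
    using rapid_summable[OF Q.rapid_theta, of "- (x powi c)"] assms
    by (simp add: v_def neg_one_powi_mult_uminus)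
  have f: "f summable_on UNIV"
  proof -
    have "(\<lambda>a. norm (u a)) summable_on UNIV" "(\<lambda>b. norm (v b)) summable_on UNIV"
      using u v by (simp_all add: summable_on_iff_abs_summable_on_complex)
    then have "(\<lambda>a. norm (f a)) summable_on UNIV \<times> UNIV"
      unfolding Infinite_Sum.abs_summable_on_Sigma_iff
      by (simp add: f_def norm_mult infsum_cmult_right' infsum_nonneg summable_on_cmult_left
          summable_on_cmult_right)
    then show ?thesis by (simp add: abs_summable_summable)
  qed
  have bij: "bij_betw h UNIV UNIV"
    by (rule bij_betw_byWitness[where f' = "\<lambda>(a, b). (a + c * b, b)"]) (auto simp: h_def)
  have fh: "(\<lambda>a. f (h a)) summable_on UNIV \<times> UNIV"
    using summable_on_reindex_bij_betw[OF bij, of f] f by simp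
  have "Theta x q * G x = infsum u UNIV * infsum v UNIV"
    using assms by (simp add: Jacobi_triple_product G_series u_def v_def)
  also have "\<dots> = (\<Sum>\<^sub>\<infinity>a. \<Sum>\<^sub>\<infinity>b. f (a, b))"
    by (simp add: f_def infsum_cmult_right' infsum_cmult_left')
  also have "\<dots> = infsum f UNIV"
    using infsum_Sigma_banach[of f UNIV "\<lambda>_. UNIV"] f by simp
  also have "\<dots> = (\<Sum>\<^sub>\<infinity>a. f (h a))"
    by (rule infsum_reindex_bij_betw[OF bij, symmetric])
  also have "\<dots> = (\<Sum>\<^sub>\<infinity>N. \<Sum>\<^sub>\<infinity>b. f (h (N, b)))"
    using infsum_Sigma_banach[OF fh] by simp
  finally have N: "Theta x q * G x = (\<Sum>\<^sub>\<infinity>N. \<Sum>\<^sub>\<infinity>b. f (h (N, b)))" .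
  have inner: "(\<Sum>\<^sub>\<infinity>b. f (h (N, b))) = mixed N * x powi N" for N
  proof -
    have "f (h (N, b)) = (- 1) powi N * q powi tri N * x powi N *
        ((- 1) powi b * (q powi (2 * t * c)) powi tri b * (q powi (c * (t - N))) powi b)" for b
    proof -
      have "2 * (tri (N - c * b) + c * tri b) = 2 * tri (N - c * b) + c * (2 * tri b)"
        by simp
      also have "\<dots> = 2 * tri N + 2 * t * c * (2 * tri b) + 2 * (c * (t - N) * b)"
        unfolding two_tri by (simp add: algebra_simps)
      also have "\<dots> = 2 * (tri N + (2 * t * c * tri b + c * (t - N) * b))"
        by (simp add: algebra_simps)
      finally have e: "tri (N - c * b) + c * tri b = tri N + (2 * t * c * tri b + c * (t - N) * b)"
        by (simp only: mult_cancel_left) simp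
      have e1: "q powi tri (N - c * b) * Q powi tri b =
          q powi tri N * ((q powi (2 * t * c)) powi tri b * (q powi (c * (t - N))) powi b)"
        using e by (simp flip: power_int_add power_int_mult)
      have e2: "x powi (N - c * b) * (x powi c) powi b = x powi N"
        using assms by (simp flip: power_int_add power_int_mult)
      have e3: "(- 1 :: complex) powi (N - c * b) = (- 1) powi N * (- 1) powi b"
        by (auto simp: neg_one_powi_cases)
      have "f (h (N, b)) = (- 1) powi (N - c * b) * (q powi tri (N - c * b) * Q powi tri b) *
          (x powi (N - c * b) * (x powi c) powi b)"
        by (simp only: f_def h_def u_def v_def prod.case mult_ac)
      then show ?thesis unfolding e1 e2 e3 by (simp only: mult_ac)
    qed
    then have "(\<Sum>\<^sub>\<infinity>b. f (h (N, b))) = (- 1) powi N * q powi tri N * x powi N *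
        Theta (q powi (c * (t - N))) (q powi (2 * t * c))"
      by (subst R.Jacobi_triple_product) (simp_all only: infsum_cmult_right', simp)
    then show ?thesis by (simp add: mixed_def mult_ac)
  qed

  have sN: "(\<lambda>N. mixed N * x powi N) summable_on UNIV"
    using summable_on_Sigma_banach[of "\<lambda>N b. f (h (N, b))" UNIV "\<lambda>_. UNIV"] fh
    by (simp add: inner split_def)
  define k :: "int \<times> int \<Rightarrow> int" where "k = (\<lambda>(s, r). s + 2 * t * r)"
  have bijk: "bij_betw k ({0..2 * t - 1} \<times> UNIV) UNIV"
    by (rule bij_betw_byWitness[where f' = "\<lambda>N. (N mod (2 * t), N div (2 * t))"])
       (use t_ge in \<open>auto simp: k_def\<close>)
  have sk: "(\<lambda>a. mixed (k a) * x powi k a) summable_on {0..2 * t - 1} \<times> UNIV"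
    using summable_on_reindex_bij_betw[OF bijk, of "\<lambda>N. mixed N * x powi N"] sN by simp
  have "(\<Sum>\<^sub>\<infinity>N. mixed N * x powi N) = (\<Sum>\<^sub>\<infinity>a\<in>{0..2 * t - 1} \<times> UNIV. mixed (k a) * x powi k a)"
    by (rule infsum_reindex_bij_betw[OF bijk, symmetric])
  also have "\<dots> = (\<Sum>\<^sub>\<infinity>s\<in>{0..2 * t - 1}. \<Sum>\<^sub>\<infinity>r. mixed (k (s, r)) * x powi k (s, r))"
    using infsum_Sigma_banach[OF sk] by simp
  also have "\<dots> = (\<Sum>s = 0..2 * t - 1. \<Sum>\<^sub>\<infinity>r. mixed (k (s, r)) * x powi k (s, r))"
    by simp
  also have "\<dots> = (\<Sum>s = 0..2 * t - 1. mixed s * x powi s * Theta (q powi s * x powi (2 * t)) (q powi (2 * t)))"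
  proof (rule sum.cong[OF refl])
    fix s
    have "mixed (k (s, r)) * x powi k (s, r) = mixed s * x powi s *
        ((- 1) powi r * (q powi (2 * t)) powi tri r * (q powi s * x powi (2 * t)) powi r)" for r
    proof -
      have "x powi (s + 2 * t * r) = x powi s * (x powi (2 * t)) powi r"
        using assms power_int_mult[of x "2 * t" r] by (simp add: power_int_add)
      then show ?thesis
        unfolding k_def prod.case mixed_shift power_int_mult_distrib by (simp only: mult_ac)
    qed
    then show "(\<Sum>\<^sub>\<infinity>r. mixed (k (s, r)) * x powi k (s, r)) =
        mixed s * x powi s * Theta (q powi s * x powi (2 * t)) (q powi (2 * t))"
      using assms by (subst P.Jacobi_triple_product) (simp_all only: infsum_cmult_right', simp)
  qed
  finally show ?thesis unfolding N inner .
qed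

section \<open>Uniqueness and the Appell function formula\<close>

text \<open>Up to powers of \<open>x\<close>, the numerators of the three kinds of Appell functions on the right-hand side of
  the theorem.\<close>
abbreviation W1 :: "complex \<Rightarrow> complex" where
  "W1 \<equiv> halved c (m - c) (\<lambda>r. Q powi tri r)"
abbreviation W2 :: "complex \<Rightarrow> complex" where
  "W2 \<equiv> halved c (- m) (\<lambda>r. Q powi tri r)"
abbreviation W3 :: "int \<Rightarrow> int \<Rightarrow> complex \<Rightarrow> complex" where
  "W3 k s \<equiv> halved (2 * t) (k + s - 2 * t)
     (\<lambda>r. (- 1) powi r * (q powi (2 * t)) powi tri r * (q powi s) powi r)"

text \<open>The right-hand side of the theorem multiplied by \<open>(q; q)^3 G(x)\<close>. Unlike the right-hand side itself it has
  no poles in the punctured plane.\<close>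
definition rhs_cleared :: "complex \<Rightarrow> complex" where
  "rhs_cleared x = qpoch q q ^ 3 * (W1 x + W2 x) -
     (\<Sum>k = 0..2 * t - 1. q powi k * theta_coeff q t (t + k) (m + k) *
        (\<Sum>s = 0..2 * t - 1. mixed s * W3 k s x))"

lemma rapid_Q: "rapid (\<lambda>r. Q powi tri r)"
  by (rule rapid_bounded_mult[OF Q.rapid_theta, where C = 1]) (simp add: norm_mult)

lemma rapid_W3: "rapid (\<lambda>r. (- 1) powi r * (q powi (2 * t)) powi tri r * (q powi s) powi r)"
proof -
  interpret P: nome "q powi (2 * t)"
    using t_ge by (intro nome_powi) simp
  show ?thesis by (intro rapid_mult_powi P.rapid_theta) simp
qed

lemma holomorphic_rhs: "rhs_cleared holomorphic_on - {0}"
  unfolding rhs_cleared_def[abs_def]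
  by (intro holomorphic_intros holomorphic_on_sum holomorphic_halved rapid_Q rapid_W3)

lemma W3_add_shift:
  assumes "x \<noteq> 0"
  shows "W3 k s x + W3 k s (q * x) =
    x powi (- 2 * t) * (x powi k * (x powi s * Theta (q powi s * x powi (2 * t)) (q powi (2 * t))))"
proof -
  interpret P: nome "q powi (2 * t)"
    using t_ge by (intro nome_powi) simp
  have "(\<Sum>\<^sub>\<infinity>r. (- 1) powi r * (q powi (2 * t)) powi tri r * (q powi s) powi r * (x powi (2 * t)) powi r)
      = Theta (q powi s * x powi (2 * t)) (q powi (2 * t))"
    using assms by (subst P.Jacobi_triple_product) (simp_all add: power_int_mult_distrib mult.assoc)
  moreover have "x powi (k + s - 2 * t) = x powi (- 2 * t) * (x powi k * x powi s)"
    using assms by (simp add: algebra_simps flip: power_int_add)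
  ultimately show ?thesis
    unfolding halved_add_shift[OF rapid_W3 assms] by (simp add: mult.assoc)
qed

lemma rhs_functional_equation:
  assumes "x \<noteq> 0"
  shows "rhs_cleared x + rhs_cleared (q * x) = x powi (- 2 * t) * G x *
     (qpoch q q ^ 3 * (x powi (m + 1) + x powi (2 * t - m)) -
      Theta x q * (\<Sum>k = 0..2 * t - 1. x powi k * q powi k * theta_coeff q t (t + k) (m + k)))"
proof -
  have W1: "W1 x + W1 (q * x) = x powi (- 2 * t) * G x * x powi (m + 1)"
  proof -
    have "x powi (m - c) = x powi (- 2 * t) * x powi (m + 1)"
      using assms by (simp add: algebra_simps flip: power_int_add)
    then show ?thesis
      unfolding halved_add_shift[OF rapid_Q assms] G_series[OF assms] by (simp add: mult_ac)
  qed
  have W2: "W2 x + W2 (q * x) = x powi (- 2 * t) * G x * x powi (2 * t - m)"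
  proof -
    have "x powi (- m) = x powi (- 2 * t) * x powi (2 * t - m)"
      using assms by (simp add: algebra_simps flip: power_int_add)
    then show ?thesis
      unfolding halved_add_shift[OF rapid_Q assms] G_series[OF assms] by (simp add: mult_ac)
  qed
  have W3: "(\<Sum>s = 0..2 * t - 1. mixed s * W3 k s x) + (\<Sum>s = 0..2 * t - 1. mixed s * W3 k s (q * x)) =
      x powi (- 2 * t) * (x powi k * (Theta x q * G x))" for k
  proof -
    have "(\<Sum>s = 0..2 * t - 1. mixed s * W3 k s x) + (\<Sum>s = 0..2 * t - 1. mixed s * W3 k s (q * x)) =
        (\<Sum>s = 0..2 * t - 1. mixed s * (W3 k s x + W3 k s (q * x)))"
      by (simp add: distrib_left sum.distrib)
    also have "\<dots> = x powi (- 2 * t) * (x powi k * (Theta x q * G x))"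
      unfolding W3_add_shift[OF assms] Theta_mult_G[OF assms] sum_distrib_left
      by (intro sum.cong refl) (simp only: mult_ac)
    finally show ?thesis .
  qed
  let ?b = "\<lambda>k. q powi k * theta_coeff q t (t + k) (m + k)"
  have "rhs_cleared x + rhs_cleared (q * x) = qpoch q q ^ 3 * ((W1 x + W1 (q * x)) + (W2 x + W2 (q * x))) -
     (\<Sum>k = 0..2 * t - 1. ?b k * ((\<Sum>s = 0..2 * t - 1. mixed s * W3 k s x) +
         (\<Sum>s = 0..2 * t - 1. mixed s * W3 k s (q * x))))"
    unfolding rhs_cleared_def by (simp only: distrib_left sum.distrib) simp
  also have "\<dots> = qpoch q q ^ 3 * (x powi (- 2 * t) * G x * x powi (m + 1) +
       x powi (- 2 * t) * G x * x powi (2 * t - m)) -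
       x powi (- 2 * t) * G x * (Theta x q * (\<Sum>k = 0..2 * t - 1. x powi k * ?b k))"
    unfolding W1 W2 W3 sum_distrib_left
    by (intro arg_cong2[where f = minus] sum.cong refl) (simp only: mult_ac)
  finally show ?thesis
    by (simp add: right_diff_distrib distrib_left mult_ac)
qed

text \<open>Both sides are holomorphic on the punctured plane and solve the same equation \<open>H(x) + H(q x) = B(x)\<close>.
  Their difference changes sign under \<open>x \<mapsto> q x\<close>, so it is a constant equal to its own negative.\<close>
lemma G_times_theta_sum:
  assumes "x \<noteq> 0" "\<And>n. x \<noteq> q powi n"
  shows "G x * theta_sum hcoeff x = rhs_cleared x"
proof -
  define D where "D = (\<lambda>x. G x * theta_sum hcoeff x - rhs_cleared x)"
  have hol: "D holomorphic_on - {0}"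
    unfolding D_def using rapid_summable[OF rapid_hcoeff, of 1]
    by (intro holomorphic_intros holomorphic_G holomorphic_theta_sum holomorphic_rhs) simp
  have eq: "D (q * y) = (- 1) * D y" if y: "y \<noteq> 0" "\<And>n. y \<noteq> q powi n" for y
  proof -
    have "x powi (2 * t) * theta_sum hcoeff x + x * theta_sum hcoeff (q * x) = R \<Longrightarrow>
      G x * theta_sum hcoeff x + G (q * x) * theta_sum hcoeff (q * x) = x powi (- 2 * t) * G x * R"
      if "x \<noteq> 0" for x R
    proof -
      assume R: "x powi (2 * t) * theta_sum hcoeff x + x * theta_sum hcoeff (q * x) = R"
      have "x powi c = x powi (2 * t) / x" using that by (simp add: power_int_diff)
      then show ?thesis
        unfolding R[symmetric] G_q_mult[OF that] using that
        by (simp add: power_int_minus field_simps)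
    qed
    from this[OF y(1) theta_sum_functional_equation[OF y]] rhs_functional_equation[OF y(1)]
    have "G y * theta_sum hcoeff y + G (q * y) * theta_sum hcoeff (q * y) = rhs_cleared y + rhs_cleared (q * y)"
      by simp
    then show ?thesis by (simp add: D_def algebra_simps)
  qed
  have "D x = D 1"
    by (rule quasiperiodic_imp_constant[OF hol _ eq assms(1)]) auto
  moreover have "D (q * x) = D 1"
    by (rule quasiperiodic_imp_constant[OF hol _ eq]) (use assms(1) in auto)
  ultimately have "D x = 0"
    using eq[OF assms] by simp
  then show ?thesis by (simp add: D_def)
qed

end

theorem theorem1p8:
  fixes q x :: complex and t m :: int
  assumes "0 < norm q" and "norm q < 1"
    and "2 \<le> t" and "1 \<le> m" and "m < t"
    and "x \<noteq> 0"
    and "\<And>n :: int. - (x powi (2 * t - 1)) \<noteq> (q powi (2 * t - 1)) powi n"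
    and "\<And>n :: int. x powi (2 * t) \<noteq> q powi n"
  shows "f_fun q t m x =
      x powi (- 2 * t + m + 1)
        * appell (x powi (- 2 * t + 1) * q powi m) (- (x powi (2 * t - 1))) (q powi (2 * t - 1))
    + x powi (- m)
        * appell (x powi (- 2 * t + 1) * q powi (2 * t - 1 - m)) (- (x powi (2 * t - 1)))
            (q powi (2 * t - 1))
    - x powi (- 2 * t) / (Theta (- (x powi (2 * t - 1))) (q powi (2 * t - 1)) * qpoch q q ^ 3)
        * (\<Sum>k = 0..2 * t - 1. x powi k * q powi k * theta_coeff q t (t + k) (m + k)
            * (\<Sum>s = 0..2 * t - 1.
                (- 1) powi s * q powi (s * (s - 1) div 2)
                * Theta (q powi ((2 * t - 1) * (t - s))) (q powi (2 * t * (2 * t - 1)))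
                * x powi s
                * Theta (q powi s * x powi (2 * t)) (q powi (2 * t))
                * appell (- (q powi k) * x powi (- 2 * t)) (q powi s * x powi (2 * t))
                    (q powi (2 * t))))"
proof -
  interpret hecke q t m
    using assms by unfold_locales auto
  interpret P: nome "q powi (2 * t)"
    using assms by (intro nome_powi) simp
  \<comment> \<open>If \<open>x\<close> were a power of \<open>q\<close>, then so would be \<open>x^(2 t)\<close>.\<close>
  have x_powi: "x \<noteq> q powi n" for n
    using assms(8)[of "n * (2 * t)"] by (auto simp: power_int_mult)
  have Gx: "G x \<noteq> 0"
    using assms(6,7) by (intro Q.Theta_nonzero) auto
  have q3: "qpoch q q \<noteq> 0" by (rule qpoch_q_nonzero)
  \<comment> \<open>In both Appell functions of nome \<open>Q\<close> the product of the two arguments is \<open>- (q^b)\<close>, so the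
    denominators are \<open>1 + q^N\<close>.\<close>
  have appellQ: "x powi a * appell (x powi (- 2 * t + 1) * q powi b) (- (x powi c)) Q =
      halved c (b - c) (\<lambda>r. Q powi tri r) x / G x" if "a = b - c" for a b
  proof -
    have "(- 1) powi r * Q powi tri r * (- (x powi c)) powi r /
        (1 - Q powi (r - 1) * (x powi (- 2 * t + 1) * q powi b) * - (x powi c)) =
        x powi (- a) * (Q powi tri r * x powi (c * r + (b - c)) / (1 + q powi (c * r + (b - c))))" for r
    proof -
      have e1: "(x powi c) powi r = x powi (- a) * x powi (c * r + (b - c))"
        using assms(6) that by (simp flip: power_int_add power_int_mult)
      have e2: "x powi (- 2 * t + 1) * x powi c = 1"
        using assms(6) by (simp flip: power_int_add)
      have e3: "Q powi (r - 1) * q powi b = q powi (c * r + (b - c))"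
        by (simp add: algebra_simps flip: power_int_add power_int_mult)
      have "Q powi (r - 1) * (x powi (- 2 * t + 1) * q powi b) * - (x powi c) =
          - ((x powi (- 2 * t + 1) * x powi c) * (Q powi (r - 1) * q powi b))"
        by (simp only: mult_minus_left mult_minus_right mult_ac)
      then have e4: "1 - Q powi (r - 1) * (x powi (- 2 * t + 1) * q powi b) * - (x powi c) =
          1 + q powi (c * r + (b - c))"
        unfolding e2 e3 by simp
      show ?thesis
        unfolding neg_one_powi_mult_uminus e1 e4 by (simp only: times_divide_eq_right mult_ac)
    qed
    then have "appell (x powi (- 2 * t + 1) * q powi b) (- (x powi c)) Q =
        1 / G x * (x powi (- a) * halved c (b - c) (\<lambda>r. Q powi tri r) x)"
      unfolding appell_def tri_def[symmetric] halved_def infsum_cmult_right'[symmetric] by simp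
    then show ?thesis using assms(6) by (simp add: power_int_minus)
  qed
  \<comment> \<open>Here the product of the two arguments is \<open>- (q^(k + s))\<close>; the theta function in front cancels the
    normalisation of the Appell function.\<close>
  have appellP: "x powi (- 2 * t) * (x powi k * (x powi s * (Theta (q powi s * x powi (2 * t)) (q powi (2 * t)) *
      appell (- (q powi k) * x powi (- 2 * t)) (q powi s * x powi (2 * t)) (q powi (2 * t))))) = W3 k s x" for k s
  proof -
    let ?z = "q powi s * x powi (2 * t)"
    have "?z \<noteq> (q powi (2 * t)) powi n" for n
      using assms(8)[of "2 * t * n - s"] by (auto simp: power_int_diff field_simps simp flip: power_int_mult)
    then have \<Theta>: "Theta ?z (q powi (2 * t)) \<noteq> 0"
      using assms(6) by (intro P.Theta_nonzero) auto
    have "(- 1) powi r * (q powi (2 * t)) powi tri r * ?z powi r /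
        (1 - (q powi (2 * t)) powi (r - 1) * (- (q powi k) * x powi (- 2 * t)) * ?z) =
        x powi (2 * t - k - s) * ((- 1) powi r * (q powi (2 * t)) powi tri r * (q powi s) powi r *
          x powi (2 * t * r + (k + s - 2 * t)) / (1 + q powi (2 * t * r + (k + s - 2 * t))))" for r
    proof -
      have 1: "?z powi r = (q powi s) powi r * (x powi (2 * t - k - s) * x powi (2 * t * r + (k + s - 2 * t)))"
        using assms(6) by (simp add: power_int_mult_distrib flip: power_int_add power_int_mult)
      have 2: "(q powi (2 * t)) powi (r - 1) * (q powi k * q powi s) = q powi (2 * t * r + (k + s - 2 * t))"
        by (simp add: algebra_simps flip: power_int_add power_int_mult)
      have 3: "x powi (- 2 * t) * x powi (2 * t) = 1"
        using assms(6) by (simp flip: power_int_add)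
      have "(q powi (2 * t)) powi (r - 1) * (- (q powi k) * x powi (- 2 * t)) * ?z =
          - ((x powi (- 2 * t) * x powi (2 * t)) * ((q powi (2 * t)) powi (r - 1) * (q powi k * q powi s)))"
        by (simp only: mult_minus_left mult_minus_right mult_ac)
      then have 4: "1 - (q powi (2 * t)) powi (r - 1) * (- (q powi k) * x powi (- 2 * t)) * ?z =
          1 + q powi (2 * t * r + (k + s - 2 * t))"
        unfolding 2 3 by simp
      show ?thesis unfolding 1 4 by (simp only: times_divide_eq_right mult_ac)
    qed
    then have "Theta ?z (q powi (2 * t)) * appell (- (q powi k) * x powi (- 2 * t)) ?z (q powi (2 * t)) =
        x powi (2 * t - k - s) * W3 k s x"
      unfolding appell_def tri_def[symmetric] halved_def infsum_cmult_right'[symmetric]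
      using \<Theta> by simp
    moreover have "x powi (- 2 * t) * (x powi k * (x powi s * x powi (2 * t - k - s))) = 1"
      using assms(6) by (simp flip: power_int_add)
    ultimately show ?thesis
      by (simp only: mult.assoc[symmetric] mult_1)
  qed
  let ?b = "\<lambda>k. q powi k * theta_coeff q t (t + k) (m + k)"
  let ?A = "\<lambda>k s. appell (- (q powi k) * x powi (- 2 * t)) (q powi s * x powi (2 * t)) (q powi (2 * t))"
  have "f_fun q t m x = rhs_cleared x / (G x * qpoch q q ^ 3)"
    unfolding f_fun_eq[OF assms(6) x_powi] G_times_theta_sum[OF assms(6) x_powi, symmetric]
    using Gx by simp
  also have "\<dots> = W1 x / G x + W2 x / G x - 1 / (G x * qpoch q q ^ 3) *
      (\<Sum>k = 0..2 * t - 1. ?b k * (\<Sum>s = 0..2 * t - 1. mixed s * W3 k s x))"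
    unfolding rhs_cleared_def using Gx q3 by (simp add: field_simps)
  also have "W1 x / G x = x powi (- 2 * t + m + 1) * appell (x powi (- 2 * t + 1) * q powi m) (- (x powi c)) Q"
    by (rule appellQ[symmetric]) simp
  also have "W2 x / G x = x powi (- m) * appell (x powi (- 2 * t + 1) * q powi (c - m)) (- (x powi c)) Q"
    using appellQ[of "- m" "c - m"] by simp
  also have "(\<Sum>k = 0..2 * t - 1. ?b k * (\<Sum>s = 0..2 * t - 1. mixed s * W3 k s x)) =
      x powi (- 2 * t) * (\<Sum>k = 0..2 * t - 1. x powi k * q powi k * theta_coeff q t (t + k) (m + k) *
        (\<Sum>s = 0..2 * t - 1. (- 1) powi s * q powi tri s * Theta (q powi (c * (t - s))) (q powi (2 * t * c)) *
          x powi s * Theta (q powi s * x powi (2 * t)) (q powi (2 * t)) * ?A k s))"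
    unfolding appellP[symmetric] mixed_def sum_distrib_left
    by (intro sum.cong refl) (simp only: mult_ac)
  finally show ?thesis
    unfolding tri_def by simp
qed

end
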